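(* Suppose $S\in{\mathcal S}_d({\mathcal U},{\mathcal Y})$ admits functional-model realizations. Then any commutative, observable, weakly coisometric realization of $S$ is unitarily equivalent to exactly one functional-model realization of $S$.
   Context: Let ${\mathbb B}^d=\{\lambda\in{\mathbb C}^d:\langle\lambda,\lambda\rangle<1\}$. ${\mathcal H}_{\mathcal Y}(k_d)$ is the reproducing kernel Hilbert space of ${\mathcal Y}$-valued functions on ${\mathbb B}^d$ with kernel $k_d(\lambda,\zeta)I_{\mathcal Y}$, $k_d(\lambda,\zeta)=1/(1-\langle\lambda,\zeta\rangle)$. ${\mathcal S}_d({\mathcal U},{\mathcal Y})$ is the set of ${\mathcal L}({\mathcal U},{\mathcal Y})$-valued holomorphic $S$ on ${\mathbb B}^d$ such that $M_S:f\mapsto Sf$ is a contraction from ${\mathcal H}_{\mathcal U}(k_d)$ into ${\mathcal H}_{\mathcal Y}(k_d)$. ${\mathcal H}(K_S)$ is the reproducing kernel Hilbert space of $K_S(\lambda,\zeta)=\frac{I-S(\lambda)S(\zeta)^*}{1-\langle\lambda,\zeta\rangle}$. $M_{\lambda_j}^*$ is the adjoint in ${\mathcal H}_{\mathcal Y}(k_d)$ of multiplication by $\lambda_j$. A realization of $S$: Hilbert space ${\mathcal X}$, $A_j\in{\mathcal L}({\mathcal X})$, $B_j\in{\mathcal L}({\mathcal U},{\mathcal X})$, $C\in{\mathcal L}({\mathcal X},{\mathcal Y})$, $D\in{\mathcal L}({\mathcal U},{\mathcal Y})$ with $S(\lambda)=D+C(I-Z(\lambda)A)^{-1}Z(\lambda)B$,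 where $A=\mathrm{col}(A_j)$, $B=\mathrm{col}(B_j)$, $Z(\lambda)=[\lambda_1I_{\mathcal X}\ \cdots\ \lambda_dI_{\mathcal X}]$; connecting operator ${\mathbf U}=\begin{bmatrix}A&B\\C&D\end{bmatrix}:{\mathcal X}\oplus{\mathcal U}\to{\mathcal X}^d\oplus{\mathcal Y}$. Commutative: the $A_j$ pairwise commute. Observable: $C(I-Z(\lambda)A)^{-1}x=0$ for all $\lambda\in{\mathbb B}^d$ implies $x=0$. Weakly coisometric: ${\mathbf U}$ is a contraction and ${\mathbf U}^*$ is isometric on ${\mathcal D}\oplus{\mathcal Y}$, ${\mathcal D}=\overline{\mathrm{span}}\{Z(\zeta)^*(I-A^*Z(\zeta)^* )^{-1}C^*y:\zeta\in{\mathbb B}^d,y\in{\mathcal Y}\}$. A functional-model realization of $S$ is a contractive realization with ${\mathcal X}={\mathcal H}(K_S)$ (assumed invariant under all $M_{\lambda_j}^*$), $A_j=M_{\lambda_j}^*|_{{\mathcal H}(K_S)}$, $Cf=f(0)$, $D=S(0)$ (only $B$ free). Two realizations with connecting operators ${\mathbf U}$ (state space ${\mathcal X}$) and $\widetilde{\mathbf U}$ (state space $\widetilde{\mathcal X}$) are unitarily equivalent if there is a unitary $U:{\mathcal X}\to\widetilde{\mathcal X}$ with $\begin{bmatrix}\oplus_{1}^dU&0\\0&I_{\mathcal Y}\end{bmatrix}{\mathbf U}=\widetilde{\mathbf U}\begin{bmatrix}U&0\\0&I_{\mathcal U}\end{bmatrix}$. *)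

theory Defs
  imports "HOL-Analysis.Analysis"
begin

class complex_vector = real_vector +
  fixes scaleC :: "complex \<Rightarrow> 'a \<Rightarrow> 'a" (infixr \<open>*\<^sub>C\<close> 75)
  assumes scaleR_scaleC: "scaleR r x = scaleC (complex_of_real r) x"
    and scaleC_add_right: "scaleC a (x + y) = scaleC a x + scaleC a y"
    and scaleC_add_left: "scaleC (a + b) x = scaleC a x + scaleC b x"
    and scaleC_scaleC: "scaleC a (scaleC b x) = scaleC (a * b) x"
    and scaleC_one: "scaleC 1 x = x"

class complex_inner = complex_vector + real_normed_vector +
  fixes cinner :: "'a \<Rightarrow> 'a \<Rightarrow> complex"
  assumes cinner_commute: "cinner x y = cnj (cinner y x)"
    and cinner_add_left: "cinner (x + y) z = cinner x z + cinner y z"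
    and cinner_scaleC_left: "cinner (scaleC r x) y = r * cinner x y"
    and cinner_ge_zero: "0 \<le> Re (cinner x x)"
    and cinner_eq_zero_iff: "cinner x x = 0 \<longleftrightarrow> x = 0"
    and norm_eq_sqrt_cinner: "norm x = sqrt (Re (cinner x x))"

class chilbert = complex_inner + complete_space

definition bounded_clinear :: "('a::complex_inner \<Rightarrow> 'b::complex_inner) \<Rightarrow> bool" where
  "bounded_clinear f \<longleftrightarrow> bounded_linear f \<and> (\<forall>c x. f (c *\<^sub>C x) = c *\<^sub>C f x)"

definition cadjoint :: "('a::complex_inner \<Rightarrow> 'b::complex_inner) \<Rightarrow> 'b \<Rightarrow> 'a" where
  "cadjoint T y = (THE v. \<forall>x. cinner (T x) y = cinner x v)"

definition dinner :: "complex ^ 'd \<Rightarrow> complex ^ 'd \<Rightarrow> complex" where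
  "dinner z w = (\<Sum>j\<in>UNIV. z $ j * cnj (w $ j))"

definition Bd :: "(complex ^ 'd) set" where
  "Bd = {z. Re (dinner z z) < 1}"

definition kd :: "complex ^ 'd \<Rightarrow> complex ^ 'd \<Rightarrow> complex" where
  "kd z w = 1 / (1 - dinner z w)"

text \<open>For an operator-valued positive kernel K on a set \<Omega>, f belongs to H(K) with norm at most c
  iff |sum_i <f(p_i), y_i>|^2 \<le> c^2 sum_{i,j} <K(p_j,p_i) y_i, y_j> for all finite families.
  Functions are extended by 0 outside \<Omega>.\<close>

definition rkhs_bounded ::
  "('i \<Rightarrow> 'i \<Rightarrow> 'y \<Rightarrow> 'y) \<Rightarrow> 'i set \<Rightarrow> ('i \<Rightarrow> 'y::complex_inner) \<Rightarrow> real \<Rightarrow> bool" where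
  "rkhs_bounded K \<Omega> f c \<longleftrightarrow> 0 \<le> c \<and>
     (\<forall>(n::nat) (p::nat \<Rightarrow> 'i) (y::nat \<Rightarrow> 'y). (\<forall>i<n. p i \<in> \<Omega>) \<longrightarrow>
        (cmod (\<Sum>i<n. cinner (f (p i)) (y i)))\<^sup>2
          \<le> c\<^sup>2 * Re (\<Sum>i<n. \<Sum>j<n. cinner (K (p j) (p i) (y i)) (y j)))"

definition rkhs :: "('i \<Rightarrow> 'i \<Rightarrow> 'y \<Rightarrow> 'y) \<Rightarrow> 'i set \<Rightarrow> ('i \<Rightarrow> 'y::complex_inner) set" where
  "rkhs K \<Omega> = {f. (\<forall>z. z \<notin> \<Omega> \<longrightarrow> f z = 0) \<and> (\<exists>c. rkhs_bounded K \<Omega> f c)}"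

definition rkhs_norm :: "('i \<Rightarrow> 'i \<Rightarrow> 'y \<Rightarrow> 'y) \<Rightarrow> 'i set \<Rightarrow> ('i \<Rightarrow> 'y::complex_inner) \<Rightarrow> real" where
  "rkhs_norm K \<Omega> f = Inf {c. rkhs_bounded K \<Omega> f c}"

text \<open>Inner product by polarization (linear in the first argument).\<close>
definition rkhs_inner ::
  "('i \<Rightarrow> 'i \<Rightarrow> 'y \<Rightarrow> 'y) \<Rightarrow> 'i set \<Rightarrow> ('i \<Rightarrow> 'y::complex_inner) \<Rightarrow> ('i \<Rightarrow> 'y) \<Rightarrow> complex" where
  "rkhs_inner K \<Omega> f g = (1/4) * (\<Sum>k<(4::nat). \<i>^k *
       complex_of_real ((rkhs_norm K \<Omega> (\<lambda>z. f z + (\<i>^k) *\<^sub>C g z))\<^sup>2))"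

definition kdI :: "complex ^ 'd \<Rightarrow> complex ^ 'd \<Rightarrow> 'y::complex_inner \<Rightarrow> 'y" where
  "kdI z w y = kd z w *\<^sub>C y"

definition KS :: "(complex ^ 'd \<Rightarrow> ('u::complex_inner \<Rightarrow>\<^sub>L 'y::complex_inner))
    \<Rightarrow> complex ^ 'd \<Rightarrow> complex ^ 'd \<Rightarrow> 'y \<Rightarrow> 'y" where
  "KS S z w y = kd z w *\<^sub>C (y - blinfun_apply (S z) (cadjoint (blinfun_apply (S w)) y))"

definition HKS :: "(complex ^ 'd \<Rightarrow> ('u::complex_inner \<Rightarrow>\<^sub>L 'y::complex_inner)) \<Rightarrow> (complex ^ 'd \<Rightarrow> 'y) set" where
  "HKS S = rkhs (KS S) Bd"

definition nKS :: "(complex ^ 'd \<Rightarrow> ('u::complex_inner \<Rightarrow>\<^sub>L 'y::complex_inner)) \<Rightarrow> (complex ^ 'd \<Rightarrow> 'y) \<Rightarrow> real" where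
  "nKS S f = rkhs_norm (KS S) Bd f"

definition Mstar :: "'d \<Rightarrow> (complex ^ 'd \<Rightarrow> 'y::complex_inner) \<Rightarrow> (complex ^ 'd::finite \<Rightarrow> 'y)" where
  "Mstar j f = (THE g. g \<in> rkhs kdI Bd \<and>
      (\<forall>h\<in>rkhs kdI Bd. rkhs_inner kdI Bd (\<lambda>z. (z $ j) *\<^sub>C h z) f = rkhs_inner kdI Bd h g))"

definition schur_class :: "(complex ^ 'd::finite \<Rightarrow> ('u::chilbert \<Rightarrow>\<^sub>L 'y::chilbert)) \<Rightarrow> bool" where
  "schur_class S \<longleftrightarrow>
     (\<forall>z\<in>Bd. \<forall>c u. blinfun_apply (S z) (c *\<^sub>C u) = c *\<^sub>C blinfun_apply (S z) u) \<and>
     (\<forall>z\<in>Bd. \<exists>L. (S has_derivative L) (at z) \<and>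
         (\<forall>c h u. blinfun_apply (L (c *s h)) u = c *\<^sub>C blinfun_apply (L h) u)) \<and>
     (\<forall>f\<in>rkhs (kdI :: _ \<Rightarrow> _ \<Rightarrow> 'u \<Rightarrow> 'u) Bd.
         (\<lambda>z. blinfun_apply (S z) (f z)) \<in> rkhs (kdI :: _ \<Rightarrow> _ \<Rightarrow> 'y \<Rightarrow> 'y) Bd \<and>
         rkhs_norm (kdI :: _ \<Rightarrow> _ \<Rightarrow> 'y \<Rightarrow> 'y) Bd (\<lambda>z. blinfun_apply (S z) (f z))
           \<le> rkhs_norm (kdI :: _ \<Rightarrow> _ \<Rightarrow> 'u \<Rightarrow> 'u) Bd f)"

definition IZA :: "complex ^ 'd \<Rightarrow> ('d::finite \<Rightarrow> 'x::complex_inner \<Rightarrow> 'x) \<Rightarrow> 'x \<Rightarrow> 'x" where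
  "IZA z A x = x - (\<Sum>j\<in>UNIV. (z $ j) *\<^sub>C A j x)"

definition is_realization ::
  "(complex ^ 'd::finite \<Rightarrow> ('u::chilbert \<Rightarrow>\<^sub>L 'y::chilbert)) \<Rightarrow> ('d \<Rightarrow> 'x::chilbert \<Rightarrow> 'x)
     \<Rightarrow> ('d \<Rightarrow> 'u \<Rightarrow> 'x) \<Rightarrow> ('x \<Rightarrow> 'y) \<Rightarrow> ('u \<Rightarrow> 'y) \<Rightarrow> bool" where
  "is_realization S A B C D \<longleftrightarrow>
     (\<forall>j. bounded_clinear (A j)) \<and> (\<forall>j. bounded_clinear (B j)) \<and>
     bounded_clinear C \<and> bounded_clinear D \<and>
     (\<forall>z\<in>Bd. bij (IZA z A) \<and>
        (\<forall>u. blinfun_apply (S z) u = D u + C (inv (IZA z A) (\<Sum>j\<in>UNIV. (z $ j) *\<^sub>C B j u))))"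

definition commutative :: "('d \<Rightarrow> 'x \<Rightarrow> 'x) \<Rightarrow> bool" where
  "commutative A \<longleftrightarrow> (\<forall>i j. A i \<circ> A j = A j \<circ> A i)"

definition observable :: "('d::finite \<Rightarrow> 'x::complex_inner \<Rightarrow> 'x) \<Rightarrow> ('x \<Rightarrow> 'y::complex_inner) \<Rightarrow> bool" where
  "observable A C \<longleftrightarrow> (\<forall>x. (\<forall>z\<in>Bd. C (inv (IZA z A) x) = 0) \<longrightarrow> x = 0)"

text \<open>The connecting operator U : X \<oplus> U \<rightarrow> X^d \<oplus> Y is a contraction.\<close>
definition contractive_conn ::
  "('d::finite \<Rightarrow> 'x::complex_inner \<Rightarrow> 'x) \<Rightarrow> ('d \<Rightarrow> 'u::complex_inner \<Rightarrow> 'x) \<Rightarrow> ('x \<Rightarrow> 'y::complex_inner) \<Rightarrow> ('u \<Rightarrow> 'y) \<Rightarrow> bool" where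
  "contractive_conn A B C D \<longleftrightarrow>
     (\<forall>x u. (\<Sum>j\<in>UNIV. (norm (A j x + B j u))\<^sup>2) + (norm (C x + D u))\<^sup>2 \<le> (norm x)\<^sup>2 + (norm u)\<^sup>2)"

definition tnorm :: "('d::finite \<Rightarrow> 'x::real_normed_vector) \<Rightarrow> real" where
  "tnorm t = sqrt (\<Sum>j\<in>UNIV. (norm (t j))\<^sup>2)"

definition Dgen :: "('d::finite \<Rightarrow> 'x::complex_inner \<Rightarrow> 'x) \<Rightarrow> ('x \<Rightarrow> 'y::complex_inner) \<Rightarrow> ('d \<Rightarrow> 'x) set" where
  "Dgen A C = {t. \<exists>\<zeta>\<in>Bd. \<exists>y.
      t = (\<lambda>j. cnj (\<zeta> $ j) *\<^sub>C
             inv (\<lambda>x. x - (\<Sum>i\<in>UNIV. cnj (\<zeta> $ i) *\<^sub>C cadjoint (A i) x)) (cadjoint C y))}"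

definition cspan_t :: "('d \<Rightarrow> 'x::complex_vector) set \<Rightarrow> ('d \<Rightarrow> 'x) set" where
  "cspan_t G = {t. \<exists>(n::nat) c g. (\<forall>i<n. g i \<in> G) \<and> t = (\<lambda>j. \<Sum>i<n. c i *\<^sub>C g i j)}"

definition Dspace :: "('d::finite \<Rightarrow> 'x::complex_inner \<Rightarrow> 'x) \<Rightarrow> ('x \<Rightarrow> 'y::complex_inner) \<Rightarrow> ('d \<Rightarrow> 'x) set" where
  "Dspace A C = {t. \<exists>s. (\<forall>n. s n \<in> cspan_t (Dgen A C)) \<and>
                        (\<lambda>n. tnorm (\<lambda>j. s n j - t j)) \<longlonglongrightarrow> 0}"

text \<open>U^* (t, y) = (\<Sum> A_j^* t_j + C^* y, \<Sum> B_j^* t_j + D^* y) is isometric on \<D> \<oplus> Y.\<close>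
definition weakly_coisometric ::
  "('d::finite \<Rightarrow> 'x::chilbert \<Rightarrow> 'x) \<Rightarrow> ('d \<Rightarrow> 'u::chilbert \<Rightarrow> 'x) \<Rightarrow> ('x \<Rightarrow> 'y::chilbert) \<Rightarrow> ('u \<Rightarrow> 'y) \<Rightarrow> bool" where
  "weakly_coisometric A B C D \<longleftrightarrow> contractive_conn A B C D \<and>
     (\<forall>t y. t \<in> Dspace A C \<longrightarrow>
        (norm ((\<Sum>j\<in>UNIV. cadjoint (A j) (t j)) + cadjoint C y))\<^sup>2
        + (norm ((\<Sum>j\<in>UNIV. cadjoint (B j) (t j)) + cadjoint D y))\<^sup>2
        = (tnorm t)\<^sup>2 + (norm y)\<^sup>2)"

text \<open>State space H(K_S), A_j = M_{\<lambda>_j}^* restricted, C f = f(0), D = S(0); only B is free.\<close>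
definition fm_realization ::
  "(complex ^ 'd::finite \<Rightarrow> ('u::chilbert \<Rightarrow>\<^sub>L 'y::chilbert)) \<Rightarrow> ('d \<Rightarrow> 'u \<Rightarrow> (complex ^ 'd \<Rightarrow> 'y)) \<Rightarrow> bool" where
  "fm_realization S Bt \<longleftrightarrow>
     (\<forall>j. \<forall>f\<in>HKS S. Mstar j f \<in> HKS S) \<and>
     (\<forall>j u. Bt j u \<in> HKS S) \<and>
     (\<forall>j u v. Bt j (u + v) = (\<lambda>z. Bt j u z + Bt j v z)) \<and>
     (\<forall>j c u. Bt j (c *\<^sub>C u) = (\<lambda>z. c *\<^sub>C Bt j u z)) \<and>
     (\<forall>f\<in>HKS S. \<forall>u.
        (\<Sum>j\<in>UNIV. (nKS S (\<lambda>z. Mstar j f z + Bt j u z))\<^sup>2)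
        + (norm (f 0 + blinfun_apply (S 0) u))\<^sup>2 \<le> (nKS S f)\<^sup>2 + (norm u)\<^sup>2) \<and>
     (\<forall>z\<in>Bd.
        bij_betw (\<lambda>f w. f w - (\<Sum>j\<in>UNIV. (z $ j) *\<^sub>C Mstar j f w)) (HKS S) (HKS S) \<and>
        (\<forall>u. blinfun_apply (S z) u = blinfun_apply (S 0) u +
              inv_into (HKS S) (\<lambda>f w. f w - (\<Sum>j\<in>UNIV. (z $ j) *\<^sub>C Mstar j f w))
                 (\<lambda>w. \<Sum>j\<in>UNIV. (z $ j) *\<^sub>C Bt j u w) 0))"

definition unitarily_equiv_fm ::
  "(complex ^ 'd::finite \<Rightarrow> ('u::chilbert \<Rightarrow>\<^sub>L 'y::chilbert)) \<Rightarrow> ('d \<Rightarrow> 'x::chilbert \<Rightarrow> 'x)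
     \<Rightarrow> ('d \<Rightarrow> 'u \<Rightarrow> 'x) \<Rightarrow> ('x \<Rightarrow> 'y) \<Rightarrow> ('u \<Rightarrow> 'y) \<Rightarrow> ('d \<Rightarrow> 'u \<Rightarrow> (complex ^ 'd \<Rightarrow> 'y)) \<Rightarrow> bool" where
  "unitarily_equiv_fm S A B C D Bt \<longleftrightarrow>
     (\<exists>V :: 'x \<Rightarrow> (complex ^ 'd \<Rightarrow> 'y).
        bij_betw V UNIV (HKS S) \<and>
        (\<forall>x y. V (x + y) = (\<lambda>z. V x z + V y z)) \<and>
        (\<forall>c x. V (c *\<^sub>C x) = (\<lambda>z. c *\<^sub>C V x z)) \<and>
        (\<forall>x. nKS S (V x) = norm x) \<and>
        (\<forall>j x u. V (A j x + B j u) = (\<lambda>z. Mstar j (V x) z + Bt j u z)) \<and>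
        (\<forall>x u. C x + D u = V x 0 + blinfun_apply (S 0) u))"

end

theory Submission
  imports Defs
begin

text \<open>The unitary is the observability map \<open>x \<mapsto> C (I - Z(\<cdot>) A)\<^sup>-\<^sup>1 x\<close>. Weak coisometry is the
  identity \<open>K\<^sub>S(z, w) = C (I - Z(z) A)\<^sup>-\<^sup>1 (I - A\<^sup>* Z(w)\<^sup>*)\<^sup>-\<^sup>1 C\<^sup>*\<close>, so this map is a
  coisometry onto \<open>H(K\<^sub>S)\<close>, and injective by observability. To see that it intertwines \<open>A\<^sub>j\<close>
  with \<open>M\<^sub>j\<^sup>*\<close>, the space \<open>H(k\<^sub>d)\<close> is modelled on the symmetric part of the full Fock space
  \<open>\<ell>\<^sup>2\<close> of words: multiplication by \<open>\<lambda>\<^sub>j\<close> is covered by the creation operator, and the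
  coefficients \<open>C A\<^sup>\<alpha> x\<close> are symmetric because the \<open>A\<^sub>j\<close> commute. Uniqueness holds because
  observability makes the intertwiner unique.\<close>

section \<open>Complex inner product spaces\<close>

text \<open>Membership in \<open>rkhs\<close> is an inequality over finite families, the norm an
  infimum, the inner product a polarization sum, and \<open>Mstar\<close> a definite description on
  top of these; none of them can be computed with directly. Each function is therefore replaced by a
  vector of a genuine Hilbert space through which the kernel factors: Riesz turns the inequality
  into a representing vector, and the one of least norm has the norm of the function. The same
  function \<open>V x\<close> receives two such vectors, the state \<open>x\<close> for
  \<open>KS S\<close> and its coefficient family for \<open>kdI\<close>; this pair links the norm of
  \<open>HKS S\<close> with \<open>Mstar\<close>, which lives in the other space. Words replace
  multi-indices because no multinomial weights then appear and the backward shift merely deletes a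
  letter. The price is that the kernel vectors no longer span, so representing vectors are not
  unique and minimality needs a proof. Weak coisometry speaks only of \<open>Dspace A C\<close>, but
  combinations of two of its generators are all that polarization consumes to recover the
  kernel.\<close>

lemma scaleC_zero_left [simp]: "0 *\<^sub>C (x::'a::complex_vector) = 0"
  using scaleC_add_left[of 0 0 x] by simp

lemma scaleC_zero_right [simp]: "c *\<^sub>C (0::'a::complex_vector) = 0"
  using scaleC_add_right[of c 0 "0::'a"] by simp

lemma scaleC_minus_left [simp]: "(- c) *\<^sub>C (x::'a::complex_vector) = - (c *\<^sub>C x)"
  using scaleC_add_left[of "- c" c x] by (simp add: eq_neg_iff_add_eq_0)

lemma scaleC_minus_right [simp]: "c *\<^sub>C (- (x::'a::complex_vector)) = - (c *\<^sub>C x)"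
  using scaleC_add_right[of c "- x" x] by (simp add: eq_neg_iff_add_eq_0)

lemma scaleC_diff_right: "c *\<^sub>C ((x::'a::complex_vector) - y) = c *\<^sub>C x - c *\<^sub>C y"
  using scaleC_add_right[of c x "- y"] by simp

lemma scaleC_sum_right: "c *\<^sub>C (\<Sum>i\<in>I. f i) = (\<Sum>i\<in>I. c *\<^sub>C (f i :: 'a::complex_vector))"
  by (induction I rule: infinite_finite_induct) (simp_all add: scaleC_add_right)

lemma cinner_zero_left [simp]: "cinner 0 (y::'a::complex_inner) = 0"
  using cinner_add_left[of 0 0 y] by simp

lemma cinner_minus_left [simp]: "cinner (- x) (y::'a::complex_inner) = - cinner x y"
  using cinner_add_left[of "- x" x y] by (simp add: eq_neg_iff_add_eq_0)

lemma cinner_diff_left: "cinner (x - y) (z::'a::complex_inner) = cinner x z - cinner y z"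
  using cinner_add_left[of x "- y" z] by simp

lemma cinner_sum_left: "cinner (\<Sum>i\<in>I. f i) (y::'a::complex_inner) = (\<Sum>i\<in>I. cinner (f i) y)"
  by (induction I rule: infinite_finite_induct) (simp_all add: cinner_add_left)

lemma cinner_add_right: "cinner (x::'a::complex_inner) (y + z) = cinner x y + cinner x z"
  by (metis cinner_add_left cinner_commute complex_cnj_add)

lemma cinner_scaleC_right: "cinner (x::'a::complex_inner) (c *\<^sub>C y) = cnj c * cinner x y"
  by (metis cinner_scaleC_left cinner_commute complex_cnj_mult)

lemma cinner_zero_right [simp]: "cinner (x::'a::complex_inner) 0 = 0"
  by (metis cinner_zero_left cinner_commute complex_cnj_zero)

lemma cinner_minus_right [simp]: "cinner (x::'a::complex_inner) (- y) = - cinner x y"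
  by (metis cinner_minus_left cinner_commute complex_cnj_minus)

lemma cinner_diff_right: "cinner (x::'a::complex_inner) (y - z) = cinner x y - cinner x z"
  using cinner_add_right[of x y "- z"] by simp

lemma cinner_sum_right: "cinner (x::'a::complex_inner) (\<Sum>i\<in>I. f i) = (\<Sum>i\<in>I. cinner x (f i))"
  by (induction I rule: infinite_finite_induct) (simp_all add: cinner_add_right)

lemma cinner_self: "cinner (x::'a::complex_inner) x = complex_of_real ((norm x)\<^sup>2)"
proof -
  have "Im (cinner x x) = 0"
    using arg_cong[OF cinner_commute[of x x], of Im] by simp
  then show ?thesis
    using cinner_ge_zero[of x] by (simp add: norm_eq_sqrt_cinner complex_eq_iff)
qed

lemma norm_scaleC: "norm (c *\<^sub>C (x::'a::complex_inner)) = cmod c * norm x"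
proof -
  have "cinner (c *\<^sub>C x) (c *\<^sub>C x) = (c * cnj c) * cinner x x"
    by (simp add: cinner_scaleC_left cinner_scaleC_right)
  then have "complex_of_real ((norm (c *\<^sub>C x))\<^sup>2) = complex_of_real ((cmod c * norm x)\<^sup>2)"
    by (simp add: cinner_self complex_norm_square[symmetric] power_mult_distrib)
  then have "(norm (c *\<^sub>C x))\<^sup>2 = (cmod c * norm x)\<^sup>2"
    by (metis of_real_eq_iff)
  then show ?thesis by (simp add: power2_eq_iff_nonneg)
qed

lemma norm_add_square: 
  "(norm ((x::'a::complex_inner) + y))\<^sup>2 = (norm x)\<^sup>2 + (norm y)\<^sup>2 + 2 * Re (cinner x y)"
proof -
  have "cinner (x + y) (x + y) = cinner x x + cinner y y + (cinner x y + cnj (cinner x y))"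
    by (metis (no_types, lifting) ab_semigroup_add_class.add_ac(1) add.commute cinner_add_left cinner_add_right cinner_commute)
  then have "Re (cinner (x + y) (x + y)) = Re (cinner x x) + Re (cinner y y) + 2 * Re (cinner x y)"
    by simp
  then show ?thesis unfolding cinner_self by (simp del: of_real_power)
qed

lemma norm_diff_square: 
  "(norm ((x::'a::complex_inner) - y))\<^sup>2 = (norm x)\<^sup>2 + (norm y)\<^sup>2 - 2 * Re (cinner x y)"
  using norm_add_square[of x "- y"] by simp

lemma cinner_Cauchy_Schwarz: "cmod (cinner (x::'a::complex_inner) y) \<le> norm x * norm y"
proof (cases "y = 0")
  case False
  define c where "c = cinner x y / complex_of_real ((norm y)\<^sup>2)"
  have ny: "norm y > 0" using False by simp
  have "cnj c * cinner x y = complex_of_real ((cmod (cinner x y))\<^sup>2 / (norm y)\<^sup>2)"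
    using complex_norm_square[of "cinner x y"] by (simp add: c_def mult.commute)
  then have e1: "Re (cinner x (c *\<^sub>C y)) = (cmod (cinner x y))\<^sup>2 / (norm y)\<^sup>2"
    by (simp only: cinner_scaleC_right Re_complex_of_real)
  have e2: "(norm (c *\<^sub>C y))\<^sup>2 = (cmod (cinner x y))\<^sup>2 / (norm y)\<^sup>2"
    using ny by (simp add: norm_scaleC c_def norm_divide norm_mult power2_eq_square)
  have "0 \<le> (norm (x - c *\<^sub>C y))\<^sup>2" by simp
  also have "\<dots> = (norm x)\<^sup>2 - (cmod (cinner x y))\<^sup>2 / (norm y)\<^sup>2"
    unfolding norm_diff_square e1 e2 by simp
  finally have "(cmod (cinner x y))\<^sup>2 \<le> (norm x * norm y)\<^sup>2"
    using ny by (simp add: field_simps power_mult_distrib)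
  then show ?thesis by (rule power2_le_imp_le) simp
qed simp

lemma tendsto_cinner_right:
  assumes "(f \<longlongrightarrow> l) F"
  shows "((\<lambda>n. cinner (x::'a::complex_inner) (f n)) \<longlongrightarrow> cinner x l) F"
proof -
  have "((\<lambda>n. norm x * norm (f n - l)) \<longlongrightarrow> norm x * norm (l - l)) F"
    by (intro tendsto_intros assms)
  then have "((\<lambda>n. norm x * norm (f n - l)) \<longlongrightarrow> 0) F" by simp
  then have "((\<lambda>n. cinner x (f n) - cinner x l) \<longlongrightarrow> 0) F"
    by (rule Lim_null_comparison[rotated])
       (simp add: cinner_diff_right[symmetric] cinner_Cauchy_Schwarz)
  then show ?thesis by (simp add: LIM_zero_iff)
qed

lemma tendsto_cinner_left:
  assumes "(f \<longlongrightarrow> l) F"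
  shows "((\<lambda>n. cinner (f n) (x::'a::complex_inner)) \<longlongrightarrow> cinner l x) F"
  by (subst (1 2) cinner_commute) (intro tendsto_cnj tendsto_cinner_right assms)

lemma cinner_ext:
  assumes "\<And>z. cinner x z = cinner y z"
  shows "x = (y::'a::complex_inner)"
proof -
  have "cinner (x - y) (x - y) = 0" by (simp add: cinner_diff_left assms)
  then show ?thesis by (simp add: cinner_eq_zero_iff)
qed

lemma cinner_ext_right:
  assumes "\<And>z. cinner z x = cinner z y"
  shows "x = (y::'a::complex_inner)"
  by (rule cinner_ext) (metis assms cinner_commute)

text \<open>The functional is given by its graph \<open>R\<close>, a linear relation whose domain need not be closed.
  The representing vector is the limit of a sequence minimising
  \<open>norm m ^ 2 - 2 * Re c\<close> over \<open>(m, c) \<in> R\<close>, which is Cauchy by the parallelogram law.\<close>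

theorem Riesz_linear_relation:
  fixes R :: "('w::chilbert \<times> complex) set"
  assumes zero: "(0, 0) \<in> R"
    and add: "\<And>m c m' c'. (m, c) \<in> R \<Longrightarrow> (m', c') \<in> R \<Longrightarrow> (m + m', c + c') \<in> R"
    and scale: "\<And>s m c. (m, c) \<in> R \<Longrightarrow> (s *\<^sub>C m, s * c) \<in> R"
    and bound: "\<And>m c. (m, c) \<in> R \<Longrightarrow> cmod c \<le> K * norm m"
    and K: "0 \<le> K"
  obtains x where "\<And>m c. (m, c) \<in> R \<Longrightarrow> c = cinner m x" "norm x \<le> K"
    "\<And>v. (\<And>m c. (m, c) \<in> R \<Longrightarrow> cinner v m = 0) \<Longrightarrow> cinner v x = 0"
proof -
  define J where "J = (\<lambda>(m::'w, c). (norm m)\<^sup>2 - 2 * Re c)"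
  have Jlow: "- K\<^sup>2 \<le> J r" if "r \<in> R" for r
  proof -
    obtain m c where r: "r = (m, c)" by force
    have "Re c \<le> K * norm m" using bound[of m c] that r complex_Re_le_cmod[of c] by simp
    moreover have "0 \<le> (norm m - K)\<^sup>2" by simp
    ultimately show ?thesis by (simp add: J_def r power2_diff mult.commute)
  qed
  define d where "d = Inf (J ` R)"
  have bdd: "bdd_below (J ` R)" using Jlow by (rule bdd_belowI2)
  have dle: "d \<le> J r" if "r \<in> R" for r
    unfolding d_def using that bdd by (intro cInf_lower) auto
  have "\<exists>r\<in>R. J r < d + 1 / real (Suc n)" for n
    using cInf_lessD[of "J ` R" "d + 1 / real (Suc n)"] zero by (auto simp: d_def)
  then obtain r where r: "\<And>n. r n \<in> R" "\<And>n. J (r n) < d + 1 / real (Suc n)"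
    by metis
  define m where "m = (\<lambda>n. fst (r n))"
  define c where "c = (\<lambda>n. snd (r n))"
  have mc: "(m n, c n) \<in> R" for n using r(1) by (simp add: m_def c_def)
  have Jmc: "J (m n, c n) < d + 1 / real (Suc n)" for n using r(2) by (simp add: m_def c_def)
  have Jlim: "(\<lambda>n. J (m n, c n)) \<longlonglongrightarrow> d"
  proof (rule tendsto_sandwich)
    show "\<forall>\<^sub>F n in sequentially. d \<le> J (m n, c n)" using dle mc by auto
    show "\<forall>\<^sub>F n in sequentially. J (m n, c n) \<le> d + 1 / real (Suc n)" using Jmc by (simp add: less_imp_le)
    show "(\<lambda>n. d + 1 / real (Suc n)) \<longlonglongrightarrow> d"
      using tendsto_add[OF tendsto_const[of d] LIMSEQ_inverse_real_of_nat] by (simp add: inverse_eq_divide)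
  qed simp
  have par: "(norm (m n - m k))\<^sup>2 \<le> 2 * (1 / real (Suc n)) + 2 * (1 / real (Suc k))" for n k
  proof -
    have "((1/2) *\<^sub>C (m n + m k), (1/2) * (c n + c k)) \<in> R"
      by (intro scale add mc)
    then have "d \<le> J ((1/2) *\<^sub>C (m n + m k), (1/2) * (c n + c k))" by (rule dle)
    then have "4 * d \<le> (norm (m n + m k))\<^sup>2 - 4 * Re (c n) - 4 * Re (c k)"
      by (simp add: J_def norm_scaleC power_mult_distrib power_divide field_simps)
    moreover have "(norm (m n))\<^sup>2 - 2 * Re (c n) < d + 1 / real (Suc n)"
        "(norm (m k))\<^sup>2 - 2 * Re (c k) < d + 1 / real (Suc k)"
      using Jmc by (auto simp: J_def)
    ultimately show ?thesis
      using norm_add_square[of "m n" "m k"] norm_diff_square[of "m n" "m k"] by linarith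
  qed
  have "Cauchy m"
  proof (rule metric_CauchyI)
    fix e :: real assume e: "0 < e"
    obtain N where N: "4 / real (Suc N) < e\<^sup>2"
    proof -
      obtain N where "inverse (real (Suc N)) < e\<^sup>2 / 4"
        using reals_Archimedean[of "e\<^sup>2 / 4"] e by auto
      then show ?thesis using that[of N] by (simp add: inverse_eq_divide)
    qed
    have "dist (m n) (m k) < e" if "N \<le> n" "N \<le> k" for n k
    proof -
      have "(norm (m n - m k))\<^sup>2 \<le> 2 * (1 / real (Suc n)) + 2 * (1 / real (Suc k))" by (rule par)
      also have "\<dots> \<le> 2 * (1 / real (Suc N)) + 2 * (1 / real (Suc N))"
        using that by (intro add_mono mult_left_mono divide_left_mono) auto
      also have "\<dots> < e\<^sup>2" using N by simp
      finally show ?thesis using e by (simp add: dist_norm power2_less_imp_less)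
    qed
    then show "\<exists>M. \<forall>n\<ge>M. \<forall>k\<ge>M. dist (m n) (m k) < e" by blast
  qed
  then obtain x where x: "m \<longlonglongrightarrow> x" using Cauchy_convergent_iff convergent_def by blast
  have rep: "b = cinner h x" if hb: "(h, b) \<in> R" for h b
  proof -
    define q where "q = cinner h x - b"
    \<comment> \<open>First-order condition at the infimum: the minimising sequence is moved by
      \<open>s\<close> times \<open>(h, b)\<close>, and \<open>n\<close> tends to infinity.\<close>
    have ineq: "0 \<le> 2 * Re (s * q) + (cmod s)\<^sup>2 * (norm h)\<^sup>2" for s
    proof -
      have "d \<le> J (m n, c n) + 2 * Re (cinner (m n) (s *\<^sub>C h)) + (cmod s)\<^sup>2 * (norm h)\<^sup>2 - 2 * Re (s * b)" for n
      proof -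
        have "(m n + s *\<^sub>C h, c n + s * b) \<in> R" by (intro add scale mc hb)
        then have "d \<le> J (m n + s *\<^sub>C h, c n + s * b)" by (rule dle)
        then show ?thesis by (simp add: J_def norm_add_square norm_scaleC power_mult_distrib)
      qed
      moreover have "(\<lambda>n. J (m n, c n) + 2 * Re (cinner (m n) (s *\<^sub>C h)) + (cmod s)\<^sup>2 * (norm h)\<^sup>2 - 2 * Re (s * b))
          \<longlonglongrightarrow> d + 2 * Re (cinner x (s *\<^sub>C h)) + (cmod s)\<^sup>2 * (norm h)\<^sup>2 - 2 * Re (s * b)"
        by (intro tendsto_intros Jlim tendsto_cinner_left x)
      ultimately have "d \<le> d + 2 * Re (cinner x (s *\<^sub>C h)) + (cmod s)\<^sup>2 * (norm h)\<^sup>2 - 2 * Re (s * b)"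
        by (intro LIMSEQ_le_const) auto
      moreover have "Re (cinner x (s *\<^sub>C h)) = Re (s * cinner h x)"
        using arg_cong[OF cinner_commute[of x "s *\<^sub>C h"], of Re] by (simp add: cinner_scaleC_left)
      ultimately show ?thesis by (simp add: q_def algebra_simps)
    qed
    \<comment> \<open>Testing with \<open>s = - t * cnj q\<close> leaves a multiple of
      \<open>(cmod q)^2\<close> whose coefficient is negative as soon as
      \<open>t * (norm h)^2 < 2\<close>; this \<open>t\<close> is one choice that also works for
      \<open>h = 0\<close>.\<close>
    define t where "t = 1 / (1 + (norm h)\<^sup>2)"
    have t: "0 < t" "t * (norm h)\<^sup>2 < 1" by (auto simp: t_def add_pos_nonneg field_simps)
    have "- complex_of_real t * cnj q * q = complex_of_real (- t * (cmod q)\<^sup>2)"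
      unfolding of_real_mult complex_norm_square by simp
    then have "Re (- complex_of_real t * cnj q * q) = - t * (cmod q)\<^sup>2"
      by (simp only: Re_complex_of_real)
    then have "0 \<le> - 2 * t * (cmod q)\<^sup>2 + t * (t * (norm h)\<^sup>2) * (cmod q)\<^sup>2"
      using ineq[of "- complex_of_real t * cnj q"]
      by (simp add: norm_mult power_mult_distrib power2_eq_square[of t] mult_ac del: Re_complex_of_real)
    also have "\<dots> = - (t * (2 - t * (norm h)\<^sup>2) * (cmod q)\<^sup>2)" by (simp add: algebra_simps)
    finally have "t * (2 - t * (norm h)\<^sup>2) * (cmod q)\<^sup>2 \<le> 0" by simp
    moreover have "0 < t * (2 - t * (norm h)\<^sup>2)" using t by simp
    ultimately have "(cmod q)\<^sup>2 \<le> 0" by (metis mult_le_cancel_left_pos mult_zero_right)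
    then show ?thesis by (simp add: q_def)
  qed
  have "cmod (cinner x x) \<le> K * norm x"
  proof (rule LIMSEQ_le)
    show "(\<lambda>n. cmod (cinner (m n) x)) \<longlonglongrightarrow> cmod (cinner x x)"
      by (intro tendsto_intros tendsto_cinner_left x)
    show "(\<lambda>n. K * norm (m n)) \<longlonglongrightarrow> K * norm x"
      by (intro tendsto_intros x)
    show "\<exists>N. \<forall>n\<ge>N. cmod (cinner (m n) x) \<le> K * norm (m n)"
      using bound[OF mc] rep[OF mc] by auto
  qed
  then have "norm x * norm x \<le> K * norm x" by (simp add: cinner_self power2_eq_square norm_mult)
  then have nx: "norm x \<le> K" using K by (cases "x = 0") auto
  \<comment> \<open>\<open>x\<close> is a limit of elements of the domain and inherits their
    orthogonality relations; minimality of representing vectors comes from here.\<close>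
  have "cinner v x = 0" if v: "\<And>m c. (m, c) \<in> R \<Longrightarrow> cinner v m = 0" for v
  proof -
    have "(\<lambda>n. cinner v (m n)) \<longlonglongrightarrow> cinner v x" by (intro tendsto_cinner_right x)
    then show ?thesis using v[OF mc] by (simp add: LIMSEQ_const_iff)
  qed
  then show ?thesis using that rep nx by blast
qed

lemma bounded_clinear_bounded_linear: "bounded_clinear f \<Longrightarrow> bounded_linear f"
  by (simp add: bounded_clinear_def)

lemma bounded_clinear_scaleC: "bounded_clinear f \<Longrightarrow> f (c *\<^sub>C x) = c *\<^sub>C f x"
  by (simp add: bounded_clinear_def)

lemma bounded_clinear_linear: "bounded_clinear f \<Longrightarrow> linear f"
  by (simp add: bounded_clinear_def bounded_linear.linear)

lemma bounded_clinearI: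
  assumes "\<And>x y. f (x + y) = f x + f y" "\<And>c x. f (c *\<^sub>C x) = c *\<^sub>C f x"
    "\<And>x. norm (f x) \<le> norm x * K"
  shows "bounded_clinear f"
  unfolding bounded_clinear_def
  using assms by (auto intro!: bounded_linear_intro[where K=K] simp: scaleR_scaleC)

lemma cadjoint_eqI:
  assumes "\<And>x. cinner (T x) y = cinner x v"
  shows "cadjoint T y = v"
  unfolding cadjoint_def
  by (rule the_equality) (use assms in \<open>auto intro: cinner_ext_right\<close>)

text \<open>\<open>cadjoint\<close> is a definite description, so a representing vector must be
  exhibited; Riesz supplies it from the graph of the everywhere defined functional
  \<open>cinner (T x) y\<close> in \<open>x\<close>.\<close>

lemma cinner_cadjoint:
  fixes T :: "'a::chilbert \<Rightarrow> 'b::complex_inner"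
  assumes T: "bounded_clinear T"
  shows "cinner x (cadjoint T y) = cinner (T x) y"
proof -
  obtain K where K: "K > 0" "\<And>x. norm (T x) \<le> norm x * K"
    using bounded_linear.pos_bounded[OF bounded_clinear_bounded_linear[OF T]] by blast
  interpret T: linear T using T by (rule bounded_clinear_linear)
  define R where "R = range (\<lambda>x. (x, cinner (T x) y))"
  obtain v where "\<And>m c. (m, c) \<in> R \<Longrightarrow> c = cinner m v"
  proof (rule Riesz_linear_relation[of R "K * norm y"])
    show "(0, 0) \<in> R" by (auto simp: R_def T.zero image_iff)
    show "cmod c \<le> K * norm y * norm m" if "(m, c) \<in> R" for m c
    proof -
      have "cmod c \<le> norm (T m) * norm y" using that by (auto simp: R_def cinner_Cauchy_Schwarz)
      also have "\<dots> \<le> norm m * K * norm y" by (intro mult_right_mono K) simp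
      finally show ?thesis by (simp add: mult_ac)
    qed
  qed (use K in \<open>auto simp: R_def T.add cinner_add_left bounded_clinear_scaleC[OF T] cinner_scaleC_left\<close>)
  then have "cinner (T x) y = cinner x v" for x by (auto simp: R_def)
  then show ?thesis using cadjoint_eqI[of T y v] by simp
qed

section \<open>Reproducing kernel spaces with a feature map\<close>

lemma sum_lessThan_add: "(\<Sum>i<n + k. h i) = (\<Sum>i<n. h i) + (\<Sum>i<k. h (n + i) :: 'a::comm_monoid_add)"
  for n k :: nat
  by (induction k) (simp_all add: add.assoc)

text \<open>The right-hand side has the shape of \<open>rkhs_inner\<close>, which is thus evaluated
  as soon as its norms are Hilbert space norms.\<close>

lemma polarization:
  "cinner (x::'a::complex_inner) y
    = (1/4) * (\<Sum>k<(4::nat). \<i>^k * complex_of_real ((norm (x + (\<i>^k) *\<^sub>C y))\<^sup>2))"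
proof -
  have "complex_of_real ((norm (x + c *\<^sub>C y))\<^sup>2)
      = cinner x x + c * cnj c * cinner y y + cnj c * cinner x y + c * cinner y x" for c
    unfolding cinner_self[symmetric]
    by (simp add: cinner_add_left cinner_add_right cinner_scaleC_left cinner_scaleC_right algebra_simps)
  moreover have "{..<4::nat} = {0, 1, 2, 3}" by auto
  moreover have "\<i> ^ 3 = - \<i>" by (simp add: power3_eq_cube)
  ultimately show ?thesis by (simp add: algebra_simps del: of_real_power)
qed

text \<open>A factorization of the kernel: \<open>K z w\<close> is the adjoint of \<open>G z\<close>
  after \<open>G w\<close>. It is used twice, with the Fock space for \<open>kdI\<close> and with
  the state space for \<open>KS S\<close>. A vector stands for a function only up to vectors
  orthogonal to all features.\<close>

locale kernel_feature =
  fixes K :: "'i \<Rightarrow> 'i \<Rightarrow> 'y \<Rightarrow> 'y::complex_inner" and \<Omega> :: "'i set" and G :: "'i \<Rightarrow> 'y \<Rightarrow> 'w::chilbert"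
  assumes kernel: "\<And>z w y y'. z \<in> \<Omega> \<Longrightarrow> w \<in> \<Omega> \<Longrightarrow> cinner (K z w y) y' = cinner (G w y) (G z y')"
    and feature_scaleC: "\<And>z c y. z \<in> \<Omega> \<Longrightarrow> G z (c *\<^sub>C y) = c *\<^sub>C G z y"
begin

definition represents :: "'w \<Rightarrow> ('i \<Rightarrow> 'y) \<Rightarrow> bool" where
  "represents x f \<longleftrightarrow> (\<forall>z. z \<notin> \<Omega> \<longrightarrow> f z = 0) \<and> (\<forall>z\<in>\<Omega>. \<forall>y. cinner (f z) y = cinner x (G z y))"

text \<open>Membership in the closed span of the features, expressed as a double orthogonal complement.\<close>
definition minimal :: "'w \<Rightarrow> bool" where
  "minimal x \<longleftrightarrow> (\<forall>v. (\<forall>z\<in>\<Omega>. \<forall>y. cinner v (G z y) = 0) \<longrightarrow> cinner v x = 0)"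

lemma minimal_orthogonal:
  assumes "minimal x" "\<And>z y. z \<in> \<Omega> \<Longrightarrow> cinner v (G z y) = 0"
  shows "cinner v x = 0"
  using assms by (auto simp: minimal_def)

lemma representsD: "represents x f \<Longrightarrow> z \<in> \<Omega> \<Longrightarrow> cinner x (G z y) = cinner (f z) y"
  by (simp add: represents_def)

lemma minimal_linear:
  assumes "minimal x" "minimal x'"
  shows "minimal (x + c *\<^sub>C x')"
  using assms by (simp add: minimal_def cinner_add_right cinner_scaleC_right)

lemma represents_linear:
  assumes "represents x f" "represents x' f'"
  shows "represents (x + c *\<^sub>C x') (\<lambda>z. f z + c *\<^sub>C f' z)"
  using assms by (simp add: represents_def cinner_add_left cinner_scaleC_left)

lemma represents_unique:
  assumes "represents x f" "represents x f'"
  shows "f = f'"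
proof
  fix z
  show "f z = f' z"
    by (cases "z \<in> \<Omega>") (use assms in \<open>auto simp: represents_def intro: cinner_ext\<close>)
qed

lemma kernel_quadratic_form:
  assumes "\<forall>i<n. p i \<in> \<Omega>"
  shows "Re (\<Sum>i<n. \<Sum>j<n. cinner (K (p j) (p i) (y i)) (y j)) = (norm (\<Sum>i<n. G (p i) (y i)))\<^sup>2"
proof -
  have "(\<Sum>i<n. \<Sum>j<n. cinner (K (p j) (p i) (y i)) (y j))
      = cinner (\<Sum>i<n. G (p i) (y i)) (\<Sum>i<n. G (p i) (y i))"
    unfolding cinner_sum_left unfolding cinner_sum_right using assms by (simp add: kernel)
  then show ?thesis by (simp add: cinner_self)
qed

lemma rkhs_bounded_represents:
  assumes "represents x f"
  shows "rkhs_bounded K \<Omega> f (norm x)"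
  unfolding rkhs_bounded_def
proof (intro conjI allI impI)
  fix n :: nat and p y assume p: "\<forall>i<n. p i \<in> \<Omega>"
  have "(\<Sum>i<n. cinner (f (p i)) (y i)) = cinner x (\<Sum>i<n. G (p i) (y i))"
    using assms p by (simp add: represents_def cinner_sum_right)
  then have "cmod (\<Sum>i<n. cinner (f (p i)) (y i)) \<le> norm x * norm (\<Sum>i<n. G (p i) (y i))"
    by (simp add: cinner_Cauchy_Schwarz)
  then have "(cmod (\<Sum>i<n. cinner (f (p i)) (y i)))\<^sup>2 \<le> (norm x * norm (\<Sum>i<n. G (p i) (y i)))\<^sup>2"
    by (intro power_mono) auto
  then show "(cmod (\<Sum>i<n. cinner (f (p i)) (y i)))\<^sup>2
      \<le> (norm x)\<^sup>2 * Re (\<Sum>i<n. \<Sum>j<n. cinner (K (p j) (p i) (y i)) (y j))"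
    by (simp only: kernel_quadratic_form[OF p] power_mult_distrib)
qed simp

lemma rkhs_represents: "represents x f \<Longrightarrow> f \<in> rkhs K \<Omega>"
  using rkhs_bounded_represents by (auto simp: rkhs_def represents_def)

text \<open>By \<open>kernel_quadratic_form\<close>, the inequality in \<open>rkhs_bounded\<close>
  says that a functional on the span of the features is bounded by \<open>c\<close>, which is the
  hypothesis of Riesz.\<close>

lemma rkhs_bounded_obtain:
  assumes f: "rkhs_bounded K \<Omega> f c" "\<And>z. z \<notin> \<Omega> \<Longrightarrow> f z = 0"
  obtains x where "represents x f" "minimal x" "norm x \<le> c"
proof -
  \<comment> \<open>A relation, since different families may give the same vector; the bound makes
    it single-valued. With \<open>y i\<close> in the first slot the second coordinate is linear, and
    pairs are added by concatenating families.\<close>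
  define R where "R = {(m, b). \<exists>(n::nat) p y. (\<forall>i<n. p i \<in> \<Omega>) \<and>
      m = (\<Sum>i<n. G (p i) (y i)) \<and> b = (\<Sum>i<n. cinner (y i) (f (p i)))}"
  have gen: "(G z y, cinner y (f z)) \<in> R" if "z \<in> \<Omega>" for z y
    unfolding R_def using that
    by (auto intro!: exI[of _ "1::nat"] exI[of _ "\<lambda>_. z"] exI[of _ "\<lambda>_. y"])
  obtain x where x: "\<And>m b. (m, b) \<in> R \<Longrightarrow> b = cinner m x" "norm x \<le> c"
    "\<And>v. (\<And>m b. (m, b) \<in> R \<Longrightarrow> cinner v m = 0) \<Longrightarrow> cinner v x = 0"
  proof (rule Riesz_linear_relation[of R c])
    show "(0, 0) \<in> R" by (auto simp: R_def intro!: exI[of _ "0::nat"])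
    show "0 \<le> c" using f(1) by (simp add: rkhs_bounded_def)
    show "(s *\<^sub>C m, s * b) \<in> R" if mb: "(m, b) \<in> R" for s m b
    proof -
      obtain n :: nat and p y where "\<forall>i<n. p i \<in> \<Omega>"
        "m = (\<Sum>i<n. G (p i) (y i))" "b = (\<Sum>i<n. cinner (y i) (f (p i)))"
        using mb unfolding R_def by blast
      then show ?thesis
        unfolding R_def
        by (auto intro!: exI[of _ n] exI[of _ p] exI[of _ "\<lambda>i. s *\<^sub>C y i"]
            simp: feature_scaleC scaleC_sum_right cinner_scaleC_left sum_distrib_left)
    qed
    show "(m + m', b + b') \<in> R" if mb: "(m, b) \<in> R" "(m', b') \<in> R" for m b m' b'
    proof -
      obtain n :: nat and p y where 1: "\<forall>i<n. p i \<in> \<Omega>"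
        "m = (\<Sum>i<n. G (p i) (y i))" "b = (\<Sum>i<n. cinner (y i) (f (p i)))"
        using mb(1) unfolding R_def by blast
      obtain k :: nat and q v where 2: "\<forall>i<k. q i \<in> \<Omega>"
        "m' = (\<Sum>i<k. G (q i) (v i))" "b' = (\<Sum>i<k. cinner (v i) (f (q i)))"
        using mb(2) unfolding R_def by blast
      show ?thesis
        unfolding R_def using 1 2
        by (auto intro!: exI[of _ "n + k"] exI[of _ "\<lambda>i. if i < n then p i else q (i - n)"]
            exI[of _ "\<lambda>i. if i < n then y i else v (i - n)"] simp: sum_lessThan_add)
    qed
    show "cmod b \<le> c * norm m" if mb: "(m, b) \<in> R" for m b
    proof -
      obtain n :: nat and p y where 1: "\<forall>i<n. p i \<in> \<Omega>"
        "m = (\<Sum>i<n. G (p i) (y i))" "b = (\<Sum>i<n. cinner (y i) (f (p i)))"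
        using mb unfolding R_def by blast
      have "b = cnj (\<Sum>i<n. cinner (f (p i)) (y i))"
        unfolding 1 cnj_sum by (intro sum.cong refl cinner_commute)
      then have "cmod b = cmod (\<Sum>i<n. cinner (f (p i)) (y i))" by (simp only: complex_mod_cnj)
      moreover have "(cmod (\<Sum>i<n. cinner (f (p i)) (y i)))\<^sup>2
          \<le> c\<^sup>2 * Re (\<Sum>i<n. \<Sum>j<n. cinner (K (p j) (p i) (y i)) (y j))"
        using f(1) 1(1) unfolding rkhs_bounded_def by blast
      ultimately have "(cmod b)\<^sup>2 \<le> (c * norm m)\<^sup>2"
        by (simp only: kernel_quadratic_form[OF 1(1)] power_mult_distrib 1(2))
      then show ?thesis
        by (rule power2_le_imp_le) (use f(1) in \<open>simp add: rkhs_bounded_def\<close>)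
    qed
  qed blast
  have "cinner (f z) y = cinner x (G z y)" if "z \<in> \<Omega>" for z y
    using x(1)[OF gen[OF that]] by (metis cinner_commute)
  then have "represents x f" using f(2) by (simp add: represents_def)
  moreover have "minimal x"
    unfolding minimal_def
  proof (intro allI impI)
    fix v assume v: "\<forall>z\<in>\<Omega>. \<forall>y. cinner v (G z y) = 0"
    show "cinner v x = 0"
      by (rule x(3)) (use v in \<open>auto simp: R_def cinner_sum_right\<close>)
  qed
  ultimately show ?thesis using that x(2) by blast
qed

lemma rkhs_obtain:
  assumes "f \<in> rkhs K \<Omega>"
  obtains x where "represents x f" "minimal x"
proof -
  obtain c where "rkhs_bounded K \<Omega> f c" "\<And>z. z \<notin> \<Omega> \<Longrightarrow> f z = 0"
    using assms unfolding rkhs_def by blast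
  then show ?thesis using that by (rule rkhs_bounded_obtain)
qed

text \<open>Representatives of \<open>f\<close> differ by vectors orthogonal to all features, hence
  to a minimal \<open>x\<close>; so \<open>x\<close> is the shortest, while every bound
  \<open>c\<close> dominates the norm of some representative.\<close>

lemma rkhs_norm_represents:
  assumes x: "represents x f" "minimal x"
  shows "rkhs_norm K \<Omega> f = norm x"
  unfolding rkhs_norm_def
proof (rule cInf_eq_minimum)
  show "norm x \<in> {c. rkhs_bounded K \<Omega> f c}" using rkhs_bounded_represents[OF x(1)] by simp
next
  fix c assume "c \<in> {c. rkhs_bounded K \<Omega> f c}"
  then have c: "rkhs_bounded K \<Omega> f c" by simp
  have "f z = 0" if "z \<notin> \<Omega>" for z using x(1) that by (simp add: represents_def)
  with c obtain x' where x': "represents x' f" "norm x' \<le> c" by (rule rkhs_bounded_obtain)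
  have "cinner (x' - x) x = 0"
    by (rule minimal_orthogonal[OF x(2)]) (simp add: cinner_diff_left representsD[OF x(1)] representsD[OF x'(1)])
  then have "cinner x' x = complex_of_real ((norm x)\<^sup>2)" by (simp add: cinner_diff_left cinner_self)
  then have "(norm x)\<^sup>2 \<le> norm x' * norm x"
    using cinner_Cauchy_Schwarz[of x' x] by (simp add: norm_power)
  then have "norm x \<le> norm x'" by (cases "x = 0") (simp_all add: power2_eq_square)
  then show "norm x \<le> c" using x'(2) by simp
qed

text \<open>The asymmetry is deliberate: changing the first representative adds a vector orthogonal
  to the minimal \<open>x'\<close>. This admits \<open>creation j m\<close>, which is not minimal in
  general, in the first slot.\<close>

lemma rkhs_inner_represents:
  assumes x: "represents x f" and x': "represents x' f'" "minimal x'"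
  shows "rkhs_inner K \<Omega> f f' = cinner x x'"
proof -
  obtain m where m: "represents m f" "minimal m"
    using rkhs_obtain[OF rkhs_represents[OF x]] by blast
  have "rkhs_norm K \<Omega> (\<lambda>z. f z + c *\<^sub>C f' z) = norm (m + c *\<^sub>C x')" for c
    by (intro rkhs_norm_represents represents_linear minimal_linear m x')
  then have "rkhs_inner K \<Omega> f f' = cinner m x'"
    by (simp add: rkhs_inner_def polarization[of m x'])
  moreover have "cinner (m - x) x' = 0"
    by (rule minimal_orthogonal[OF x'(2)]) (simp add: cinner_diff_left representsD[OF x] representsD[OF m(1)])
  ultimately show ?thesis by (simp add: cinner_diff_left)
qed

end

section \<open>Square-summable families\<close>

typedef (overloaded) ('i, 'a) ell2 =
  "{f :: 'i \<Rightarrow> 'a::complex_inner. (\<lambda>i. (norm (f i))\<^sup>2) summable_on UNIV}"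
  morphisms ell2_nth Abs_ell2
  by (rule exI[of _ "\<lambda>_. 0"]) simp

setup_lifting type_definition_ell2

lemma square_summable_bounded:
  fixes f :: "'i \<Rightarrow> 'a::real_normed_vector"
  assumes "\<And>F. finite F \<Longrightarrow> (\<Sum>i\<in>F. (norm (f i))\<^sup>2) \<le> K"
  shows "(\<lambda>i. (norm (f i))\<^sup>2) summable_on UNIV"
  by (rule nonneg_bdd_above_summable_on) (use assms in \<open>auto intro!: bdd_aboveI2[where M=K]\<close>)

lemma square_summable_add:
  fixes f g :: "'i \<Rightarrow> 'a::real_normed_vector"
  assumes "(\<lambda>i. (norm (f i))\<^sup>2) summable_on UNIV" "(\<lambda>i. (norm (g i))\<^sup>2) summable_on UNIV"
  shows "(\<lambda>i. (norm (f i + g i))\<^sup>2) summable_on UNIV"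
proof (rule summable_on_comparison_test)
  show "(\<lambda>i. 2 * (norm (f i))\<^sup>2 + 2 * (norm (g i))\<^sup>2) summable_on UNIV"
    by (intro summable_on_add summable_on_cmult_right assms)
  fix i
  have "(norm (f i + g i))\<^sup>2 \<le> (norm (f i) + norm (g i))\<^sup>2"
    by (intro power_mono norm_triangle_ineq) simp
  also have "\<dots> \<le> 2 * (norm (f i))\<^sup>2 + 2 * (norm (g i))\<^sup>2"
    using zero_le_power2[of "norm (f i) - norm (g i)"] unfolding power2_sum power2_diff by linarith
  finally show "(norm (f i + g i))\<^sup>2 \<le> 2 * (norm (f i))\<^sup>2 + 2 * (norm (g i))\<^sup>2" .
qed simp

lemma cinner_summable:
  fixes f g :: "'i \<Rightarrow> 'a::complex_inner"
  assumes "(\<lambda>i. (norm (f i))\<^sup>2) summable_on UNIV" "(\<lambda>i. (norm (g i))\<^sup>2) summable_on UNIV"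
  shows "(\<lambda>i. cinner (f i) (g i)) summable_on UNIV"
proof (rule abs_summable_summable, rule Infinite_Sum.abs_summable_on_comparison_test)
  show "(\<lambda>i. norm ((norm (f i))\<^sup>2 + (norm (g i))\<^sup>2)) summable_on UNIV"
    using summable_on_add[OF assms] by simp
  fix i
  have "norm (f i) * norm (g i) \<le> (norm (f i))\<^sup>2 + (norm (g i))\<^sup>2"
    using zero_le_power2[of "norm (f i) - norm (g i)"] zero_le_power2[of "norm (f i)"] zero_le_power2[of "norm (g i)"]
    unfolding power2_diff by linarith
  then show "norm (cinner (f i) (g i)) \<le> norm ((norm (f i))\<^sup>2 + (norm (g i))\<^sup>2)"
    using cinner_Cauchy_Schwarz[of "f i" "g i"] by simp
qed

instantiation ell2 :: (type, complex_inner) complex_vector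
begin

lift_definition zero_ell2 :: "('a, 'b) ell2" is "\<lambda>_. 0" by simp

lift_definition plus_ell2 :: "('a, 'b) ell2 \<Rightarrow> ('a, 'b) ell2 \<Rightarrow> ('a, 'b) ell2" is "\<lambda>f g i. f i + g i"
  by (rule square_summable_add)

lift_definition uminus_ell2 :: "('a, 'b) ell2 \<Rightarrow> ('a, 'b) ell2" is "\<lambda>f i. - f i" by simp

lift_definition scaleC_ell2 :: "complex \<Rightarrow> ('a, 'b) ell2 \<Rightarrow> ('a, 'b) ell2" is "\<lambda>c f i. c *\<^sub>C f i"
  by (simp add: norm_scaleC power_mult_distrib summable_on_cmult_right)

definition minus_ell2 :: "('a, 'b) ell2 \<Rightarrow> ('a, 'b) ell2 \<Rightarrow> ('a, 'b) ell2" where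
  "minus_ell2 f g = f + - g"

definition scaleR_ell2 :: "real \<Rightarrow> ('a, 'b) ell2 \<Rightarrow> ('a, 'b) ell2" where
  "scaleR_ell2 r f = complex_of_real r *\<^sub>C f"

instance
proof
  fix f g h :: "('a, 'b) ell2" and a b :: complex and r s :: real
  show "f + g + h = f + (g + h)" by transfer (simp add: add.assoc)
  show "f + g = g + f" by transfer (simp add: add.commute)
  show "0 + f = f" by transfer simp
  show "- f + f = 0" by transfer simp
  show "f - g = f + - g" by (simp add: minus_ell2_def)
  show "r *\<^sub>R f = complex_of_real r *\<^sub>C f" by (simp add: scaleR_ell2_def)
  show R: "a *\<^sub>C (f + g) = a *\<^sub>C f + a *\<^sub>C g" for a and f g :: "('a, 'b) ell2" by transfer (simp add: scaleC_add_right)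
  show L: "(a + b) *\<^sub>C f = a *\<^sub>C f + b *\<^sub>C f" for a b and f :: "('a, 'b) ell2" by transfer (simp add: scaleC_add_left)
  show S: "a *\<^sub>C b *\<^sub>C f = (a * b) *\<^sub>C f" for a b and f :: "('a, 'b) ell2" by transfer (simp add: scaleC_scaleC)
  show O: "1 *\<^sub>C f = f" for f :: "('a, 'b) ell2" by transfer (simp add: scaleC_one)
  show "r *\<^sub>R (f + g) = r *\<^sub>R f + r *\<^sub>R g" by (simp add: scaleR_ell2_def R)
  show "(r + s) *\<^sub>R f = r *\<^sub>R f + s *\<^sub>R f" by (simp add: scaleR_ell2_def L)
  show "r *\<^sub>R s *\<^sub>R f = (r * s) *\<^sub>R f" by (simp add: scaleR_ell2_def S)
  show "1 *\<^sub>R f = f" by (simp add: scaleR_ell2_def O)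
qed

end

lemma ell2_nth_zero [simp]: "ell2_nth 0 i = 0" by transfer simp
lemma ell2_nth_add [simp]: "ell2_nth (f + g) i = ell2_nth f i + ell2_nth g i" by transfer simp
lemma ell2_nth_uminus [simp]: "ell2_nth (- f) i = - ell2_nth f i" by transfer simp
lemma ell2_nth_diff [simp]: "ell2_nth (f - g) i = ell2_nth f i - ell2_nth g i"
  by (simp only: diff_conv_add_uminus ell2_nth_add ell2_nth_uminus)
lemma ell2_nth_scaleC [simp]: "ell2_nth (c *\<^sub>C f) i = c *\<^sub>C ell2_nth f i" by transfer simp

lemma ell2_eqI: "(\<And>i. ell2_nth f i = ell2_nth g i) \<Longrightarrow> f = g"
  by transfer (simp add: fun_eq_iff)

lemma ell2_summable: "(\<lambda>i. (norm (ell2_nth f i))\<^sup>2) summable_on UNIV" by transfer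

instantiation ell2 :: (type, complex_inner) complex_inner
begin

definition cinner_ell2 :: "('a, 'b) ell2 \<Rightarrow> ('a, 'b) ell2 \<Rightarrow> complex" where
  "cinner_ell2 f g = (\<Sum>\<^sub>\<infinity>i. cinner (ell2_nth f i) (ell2_nth g i))"

definition norm_ell2 :: "('a, 'b) ell2 \<Rightarrow> real" where
  "norm_ell2 f = sqrt (\<Sum>\<^sub>\<infinity>i. (norm (ell2_nth f i))\<^sup>2)"

definition sgn_ell2 :: "('a, 'b) ell2 \<Rightarrow> ('a, 'b) ell2" where
  "sgn_ell2 f = f /\<^sub>R norm f"

definition dist_ell2 :: "('a, 'b) ell2 \<Rightarrow> ('a, 'b) ell2 \<Rightarrow> real" where
  "dist_ell2 f g = norm (f - g)"

definition uniformity_ell2 :: "(('a, 'b) ell2 \<times> ('a, 'b) ell2) filter" where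
  "uniformity_ell2 = (INF e\<in>{0 <..}. principal {(f, g). dist f g < e})"

definition open_ell2 :: "('a, 'b) ell2 set \<Rightarrow> bool" where
  "open_ell2 U \<longleftrightarrow> (\<forall>x\<in>U. eventually (\<lambda>(x', y). x' = x \<longrightarrow> y \<in> U) uniformity)"

instance
proof
  fix f g h :: "('a, 'b) ell2" and c :: complex and r :: real and U :: "('a, 'b) ell2 set"
  have inf_cinner: "cinner f f = complex_of_real (\<Sum>\<^sub>\<infinity>i. (norm (ell2_nth f i))\<^sup>2)" for f :: "('a, 'b) ell2"
    unfolding cinner_ell2_def cinner_self by (intro infsumI has_sum_of_real has_sum_infsum ell2_summable)
  have summ: "(\<lambda>i. cinner (ell2_nth f i) (ell2_nth g i)) summable_on UNIV" for f g :: "('a, 'b) ell2"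
    by (intro cinner_summable ell2_summable)
  show "dist f g = norm (f - g)" by (fact dist_ell2_def)
  show "sgn f = f /\<^sub>R norm f" by (fact sgn_ell2_def)
  show "uniformity = (INF e\<in>{0 <..}. principal {(f, g::('a, 'b) ell2). dist f g < e})"
    by (fact uniformity_ell2_def)
  show "open U = (\<forall>x\<in>U. \<forall>\<^sub>F (x', y) in uniformity. x' = x \<longrightarrow> y \<in> U)" by (fact open_ell2_def)
  show "(norm f = 0) = (f = 0)"
  proof
    assume "norm f = 0"
    then have 0: "(\<Sum>\<^sub>\<infinity>i. (norm (ell2_nth f i))\<^sup>2) = 0" by (simp add: norm_ell2_def)
    have "(norm (ell2_nth f i))\<^sup>2 = 0" for i
      by (rule nonneg_infsum_le_0D[OF _ ell2_summable]) (simp_all add: 0)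
    then show "f = 0" by (intro ell2_eqI) simp
  qed (simp add: norm_ell2_def)
  have normC: "norm (c *\<^sub>C f) = cmod c * norm f" for c and f :: "('a, 'b) ell2"
    by (simp add: norm_ell2_def norm_scaleC power_mult_distrib infsum_cmult_right' real_sqrt_mult)
  show "norm (r *\<^sub>R f) = \<bar>r\<bar> * norm f" by (simp add: scaleR_ell2_def normC)
  show "norm (f + g) \<le> norm f + norm g"
  proof -
    have part: "(\<Sum>i\<in>F. (norm (ell2_nth (f + g) i))\<^sup>2) \<le> (norm f + norm g)\<^sup>2" if "finite F" for F
    proof -
      have fin: "L2_set (\<lambda>i. norm (ell2_nth h i)) F \<le> norm h" for h :: "('a, 'b) ell2"
        unfolding L2_set_def norm_ell2_def real_sqrt_le_iff
        by (rule finite_sum_le_infsum[OF ell2_summable that]) auto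
      have "L2_set (\<lambda>i. norm (ell2_nth (f + g) i)) F
          \<le> L2_set (\<lambda>i. norm (ell2_nth f i) + norm (ell2_nth g i)) F"
        by (rule L2_set_mono) (auto simp: norm_triangle_ineq)
      also have "\<dots> \<le> L2_set (\<lambda>i. norm (ell2_nth f i)) F + L2_set (\<lambda>i. norm (ell2_nth g i)) F"
        by (rule L2_set_triangle_ineq)
      also have "\<dots> \<le> norm f + norm g" by (intro add_mono fin)
      finally show ?thesis unfolding L2_set_def by (rule sqrt_le_D)
    qed
    have "(\<Sum>\<^sub>\<infinity>i. (norm (ell2_nth (f + g) i))\<^sup>2) \<le> (norm f + norm g)\<^sup>2"
      by (rule infsum_le_finite_sums[OF ell2_summable]) (rule part)
    moreover have "0 \<le> norm f + norm g" by (simp add: norm_ell2_def infsum_nonneg)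
    ultimately show ?thesis unfolding norm_ell2_def[of "f + g"] by (rule real_le_lsqrt[rotated])
  qed
  show "cinner f g = cnj (cinner g f)"
    unfolding cinner_ell2_def infsum_cnj[symmetric] by (intro infsum_cong cinner_commute)
  show "cinner (f + g) h = cinner f h + cinner g h"
    unfolding cinner_ell2_def by (simp add: cinner_add_left infsum_add summ)
  show "cinner (c *\<^sub>C f) g = c * cinner f g"
    unfolding cinner_ell2_def by (simp add: cinner_scaleC_left infsum_cmult_right')
  show "0 \<le> Re (cinner f f)" by (simp add: inf_cinner infsum_nonneg)
  show "norm f = sqrt (Re (cinner f f))" by (simp add: inf_cinner norm_ell2_def)
  show "(cinner f f = 0) = (f = 0)"
    using \<open>(norm f = 0) = (f = 0)\<close> by (simp add: inf_cinner norm_ell2_def)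
qed

end

lemma norm_ell2_square: "(norm f)\<^sup>2 = (\<Sum>\<^sub>\<infinity>i. (norm (ell2_nth f i))\<^sup>2)"
  by (simp add: norm_ell2_def infsum_nonneg)

lemma ell2_finite_sum_le:
  assumes "finite F"
  shows "(\<Sum>i\<in>F. (norm (ell2_nth f i))\<^sup>2) \<le> (norm f)\<^sup>2"
  unfolding norm_ell2_square by (rule finite_sum_le_infsum[OF ell2_summable assms]) auto

lemma norm_ell2_nth_le: "norm (ell2_nth f i) \<le> norm f"
  using ell2_finite_sum_le[of "{i}" f] by (simp add: power2_le_iff_abs_le)

lemma ell2_cinner_has_sum:
  "((\<lambda>i. cinner (ell2_nth f i) (ell2_nth g i)) has_sum cinner f g) UNIV"
  unfolding cinner_ell2_def by (intro has_sum_infsum cinner_summable ell2_summable)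

instance ell2 :: (type, chilbert) chilbert
proof
  fix X :: "nat \<Rightarrow> ('a, 'b) ell2" assume X: "Cauchy X"
  have "Cauchy (\<lambda>n. ell2_nth (X n) i)" for i
  proof (rule metric_CauchyI)
    fix e :: real assume "0 < e"
    then obtain M where "\<forall>m\<ge>M. \<forall>n\<ge>M. dist (X m) (X n) < e" using metric_CauchyD[OF X] by blast
    then show "\<exists>M. \<forall>m\<ge>M. \<forall>n\<ge>M. dist (ell2_nth (X m) i) (ell2_nth (X n) i) < e"
      using norm_ell2_nth_le[of "X _ - X _" i] by (metis dist_norm ell2_nth_diff le_less_trans)
  qed
  then have "\<exists>l. (\<lambda>n. ell2_nth (X n) i) \<longlonglongrightarrow> l" for i
    using Cauchy_convergent_iff convergent_def by blast
  then obtain l where l: "\<And>i. (\<lambda>n. ell2_nth (X n) i) \<longlonglongrightarrow> l i" by metis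
  \<comment> \<open>On a finite set \<open>F\<close> the limit in \<open>n\<close> is termwise; the
    bound is uniform in \<open>F\<close> and so passes to the infinite sum.\<close>
  have tail: "(\<Sum>i\<in>F. (norm (ell2_nth (X m) i - l i))\<^sup>2) \<le> e\<^sup>2"
    if "finite F" "\<And>n. n \<ge> M \<Longrightarrow> dist (X m) (X n) < e" for F m M e
  proof (rule LIMSEQ_le_const2)
    show "(\<lambda>n. \<Sum>i\<in>F. (norm (ell2_nth (X m) i - ell2_nth (X n) i))\<^sup>2)
        \<longlonglongrightarrow> (\<Sum>i\<in>F. (norm (ell2_nth (X m) i - l i))\<^sup>2)"
      by (intro tendsto_intros l)
    show "\<exists>N. \<forall>n\<ge>N. (\<Sum>i\<in>F. (norm (ell2_nth (X m) i - ell2_nth (X n) i))\<^sup>2) \<le> e\<^sup>2"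
    proof (intro exI allI impI)
      fix n assume "M \<le> n"
      then have "(norm (X m - X n))\<^sup>2 \<le> e\<^sup>2"
        using that(2)[of n] by (intro power_mono) (auto simp: dist_norm)
      then show "(\<Sum>i\<in>F. (norm (ell2_nth (X m) i - ell2_nth (X n) i))\<^sup>2) \<le> e\<^sup>2"
        using ell2_finite_sum_le[OF that(1), of "X m - X n"] by simp
    qed
  qed
  \<comment> \<open>Tolerance 1 is enough to see that \<open>l\<close> differs from
    \<open>X M\<close> by a square-summable family, hence is square-summable itself.\<close>
  obtain M where M: "\<And>m n. m \<ge> M \<Longrightarrow> n \<ge> M \<Longrightarrow> dist (X m) (X n) < 1"
    using metric_CauchyD[OF X zero_less_one] by blast
  have "(\<lambda>i. (norm (ell2_nth (X M) i - l i))\<^sup>2) summable_on UNIV"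
    by (rule square_summable_bounded[where K="1\<^sup>2"]) (rule tail[where M=M], use M in auto)
  then have "(\<lambda>i. (norm (ell2_nth (- X M) i + (ell2_nth (X M) i - l i)))\<^sup>2) summable_on UNIV"
    by (intro square_summable_add ell2_summable)
  then have "(\<lambda>i. (norm (l i))\<^sup>2) summable_on UNIV" by simp
  then have L: "ell2_nth (Abs_ell2 l) i = l i" for i by (simp add: Abs_ell2_inverse)
  have "X \<longlonglongrightarrow> Abs_ell2 l"
  proof (rule metric_LIMSEQ_I)
    fix e :: real assume "0 < e"
    then obtain M where M: "\<And>m n. m \<ge> M \<Longrightarrow> n \<ge> M \<Longrightarrow> dist (X m) (X n) < e / 2"
      using metric_CauchyD[OF X, of "e / 2"] by auto
    have "dist (X m) (Abs_ell2 l) < e" if "m \<ge> M" for m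
    proof -
      have "(norm (X m - Abs_ell2 l))\<^sup>2 \<le> (e / 2)\<^sup>2"
        unfolding norm_ell2_square
        by (rule infsum_le_finite_sums[OF ell2_summable])
           (use tail[of _ M m "e / 2"] M that in \<open>simp add: L\<close>)
      then have "norm (X m - Abs_ell2 l) \<le> e / 2" using \<open>0 < e\<close> by (simp add: power2_le_iff_abs_le)
      then show ?thesis using \<open>0 < e\<close> by (simp add: dist_norm)
    qed
    then show "\<exists>no. \<forall>n\<ge>no. dist (X n) (Abs_ell2 l) < e" by blast
  qed
  then show "convergent X" by (auto simp: convergent_def)
qed

section \<open>The Drury--Arveson space as a quotient of the Fock space\<close>

lemma finite_words [simp]: "finite {\<alpha> :: 'd::finite list. length \<alpha> = n}"
  using finite_lists_length_eq[of "UNIV :: 'd set" n] by simp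

lemma sum_words_Suc:
  "(\<Sum>\<alpha> | length \<alpha> = Suc n. h \<alpha>) = (\<Sum>j\<in>UNIV. \<Sum>\<alpha> | length \<alpha> = n. h (j # \<alpha>) )"
  for h :: "'d::finite list \<Rightarrow> 'a::comm_monoid_add"
proof -
  have "{\<alpha> :: 'd list. length \<alpha> = Suc n} = (\<lambda>(j, \<alpha>). j # \<alpha>) ` (UNIV \<times> {\<alpha>. length \<alpha> = n})"
    by (auto simp: length_Suc_conv image_iff)
  moreover have "inj_on (\<lambda>(j, \<alpha>). j # \<alpha>) (UNIV \<times> {\<alpha> :: 'd list. length \<alpha> = n})"
    by (auto simp: inj_on_def)
  ultimately show ?thesis
    by (simp add: sum.reindex sum.cartesian_product case_prod_unfold)
qed

lemma sum_words_lessThan: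
  "(\<Sum>n<N. \<Sum>\<alpha> | length \<alpha> = n. h \<alpha>) = (\<Sum>\<alpha> | length \<alpha> < N. h \<alpha> )"
  for h :: "'d::finite list \<Rightarrow> 'a::comm_monoid_add"
proof -
  have "{\<alpha> :: 'd list. length \<alpha> < N} = (\<Union>n<N. {\<alpha>. length \<alpha> = n})" by auto
  then show ?thesis by (simp add: sum.UNION_disjoint disjoint_iff)
qed

lemma finite_words_less [simp]: "finite {\<alpha> :: 'd::finite list. length \<alpha> < N}"
proof -
  have "{\<alpha> :: 'd list. length \<alpha> < N} = (\<Union>n<N. {\<alpha>. length \<alpha> = n})" by auto
  then show ?thesis by simp
qed

lemma finite_subset_words_less:
  assumes "finite F"
  obtains N where "F \<subseteq> {\<alpha> :: 'd list. length \<alpha> < N}"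
proof
  show "F \<subseteq> {\<alpha>. length \<alpha> < Suc (Max (length ` F))}"
    using assms by (auto simp: less_Suc_eq_le)
qed

text \<open>The sets of words shorter than \<open>N\<close> eventually contain every finite set of
  words, so an unconditional sum may be evaluated degree by degree.\<close>

lemma has_sum_words_sums:
  fixes f :: "'d::finite list \<Rightarrow> 'a::real_normed_vector"
  assumes "(f has_sum s) UNIV"
  shows "(\<lambda>n. \<Sum>\<alpha> | length \<alpha> = n. f \<alpha>) sums s"
proof -
  have "filterlim (\<lambda>N. {\<alpha> :: 'd list. length \<alpha> < N}) (finite_subsets_at_top UNIV) sequentially"
    unfolding filterlim_finite_subsets_at_top
  proof (intro allI impI)
    fix X :: "'d list set" assume "finite X \<and> X \<subseteq> UNIV"
    then obtain N where "X \<subseteq> {\<alpha>. length \<alpha> < N}" using finite_subset_words_less by blast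
    then show "\<forall>\<^sub>F N in sequentially. finite {\<alpha> :: 'd list. length \<alpha> < N} \<and> X \<subseteq> {\<alpha>. length \<alpha> < N} \<and> {\<alpha>. length \<alpha> < N} \<subseteq> UNIV"
      by (intro eventually_sequentiallyI[of N]) auto
  qed
  then have "(\<lambda>N. sum f {\<alpha>. length \<alpha> < N}) \<longlonglongrightarrow> s"
    using assms unfolding has_sum_def by (rule filterlim_compose[rotated])
  then show ?thesis by (simp add: sums_def sum_words_lessThan)
qed

lemma square_summable_words:
  fixes f :: "'d::finite list \<Rightarrow> 'a::real_normed_vector"
  assumes "\<And>N. (\<Sum>n<N. \<Sum>\<alpha> | length \<alpha> = n. (norm (f \<alpha>))\<^sup>2) \<le> K"
  shows "(\<lambda>\<alpha>. (norm (f \<alpha>))\<^sup>2) summable_on UNIV"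
proof (rule square_summable_bounded)
  fix F :: "'d list set" assume "finite F"
  then obtain N where "F \<subseteq> {\<alpha>. length \<alpha> < N}" using finite_subset_words_less by blast
  then have "(\<Sum>\<alpha>\<in>F. (norm (f \<alpha>))\<^sup>2) \<le> (\<Sum>\<alpha> | length \<alpha> < N. (norm (f \<alpha>))\<^sup>2)"
    by (intro sum_mono2) auto
  also have "\<dots> \<le> K" using assms[of N] by (simp add: sum_words_lessThan)
  finally show "(\<Sum>\<alpha>\<in>F. (norm (f \<alpha>))\<^sup>2) \<le> K" .
qed

definition word_monomial :: "complex ^ 'd \<Rightarrow> 'd list \<Rightarrow> complex" where
  "word_monomial z \<alpha> = prod_list (map (($) z) \<alpha>)"

lemma word_monomial_simps [simp]:
  "word_monomial z [] = 1" "word_monomial z (j # \<alpha>) = z $ j * word_monomial z \<alpha>"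
  by (simp_all add: word_monomial_def)

lemma word_monomial_scale: "word_monomial (c *s z) \<alpha> = c ^ length \<alpha> * word_monomial z \<alpha>"
  by (induction \<alpha>) simp_all

text \<open>Multiplying out the power without collecting equal factors gives one term per word,
  hence no multinomial coefficients.\<close>

lemma sum_word_monomial:
  "(\<Sum>\<alpha> | length \<alpha> = n. word_monomial z \<alpha> * cnj (word_monomial w \<alpha>)) = dinner z w ^ n"
proof (induction n)
  case (Suc n)
  have "(\<Sum>\<alpha> | length \<alpha> = Suc n. word_monomial z \<alpha> * cnj (word_monomial w \<alpha>))
      = (\<Sum>j\<in>UNIV. (z $ j * cnj (w $ j)) * (\<Sum>\<alpha> | length \<alpha> = n. word_monomial z \<alpha> * cnj (word_monomial w \<alpha>)))"
    by (simp add: sum_words_Suc sum_distrib_left mult_ac)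
  also have "\<dots> = dinner z w * dinner z w ^ n"
    by (simp add: Suc dinner_def sum_distrib_right)
  finally show ?case by simp
qed simp

lemma dinner_self: "dinner z z = complex_of_real ((norm z)\<^sup>2)"
  by (simp add: dinner_def norm_vec_def L2_set_def sum_nonneg complex_norm_square del: of_real_power)

lemma mem_Bd_iff: "z \<in> Bd \<longleftrightarrow> norm z < 1"
  by (simp add: Bd_def dinner_self abs_square_less_1 del: of_real_power)

lemma cmod_dinner_le: "cmod (dinner z w) \<le> norm z * norm w"
proof -
  have "cmod (dinner z w) \<le> (\<Sum>j\<in>UNIV. \<bar>cmod (z $ j)\<bar> * \<bar>cmod (w $ j)\<bar>)"
    unfolding dinner_def by (rule order_trans[OF norm_sum]) (simp add: norm_mult)
  also have "\<dots> \<le> norm z * norm w"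
    unfolding norm_vec_def by (rule L2_set_mult_ineq)
  finally show ?thesis .
qed

lemma cmod_dinner_less_1:
  assumes "z \<in> Bd" "w \<in> Bd"
  shows "cmod (dinner z w) < 1"
proof -
  have "norm z * norm w < 1 * 1" using assms by (intro mult_strict_mono') (auto simp: mem_Bd_iff)
  then show ?thesis using cmod_dinner_le[of z w] by simp
qed

text \<open>For \<open>w\<close> in \<open>Bd\<close> the squared norms, grouped by word length,
  form a geometric series with ratio \<open>(norm w)^2\<close>; \<open>fock_kernel_nth\<close>
  unfolds \<open>Abs_ell2\<close> under this condition.\<close>

definition fock_kernel :: "complex ^ 'd \<Rightarrow> 'y::complex_inner \<Rightarrow> ('d::finite list, 'y) ell2" where
  "fock_kernel w y = Abs_ell2 (\<lambda>\<alpha>. cnj (word_monomial w \<alpha>) *\<^sub>C y)"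

lemma fock_kernel_nth:
  assumes "w \<in> Bd"
  shows "ell2_nth (fock_kernel w y) \<alpha> = cnj (word_monomial w \<alpha>) *\<^sub>C y"
proof -
  have norm_w: "norm w < 1" "0 \<le> (norm w)\<^sup>2" "(norm w)\<^sup>2 < 1"
    using assms by (auto simp: mem_Bd_iff abs_square_less_1)
  have *: "(\<Sum>\<alpha> | length \<alpha> = n. (norm (cnj (word_monomial w \<alpha>) *\<^sub>C y))\<^sup>2) = ((norm w)\<^sup>2) ^ n * (norm y)\<^sup>2" for n
  proof -
    have "complex_of_real (\<Sum>\<alpha> | length \<alpha> = n. (cmod (word_monomial w \<alpha>))\<^sup>2) = dinner w w ^ n"
      unfolding of_real_sum complex_norm_square by (rule sum_word_monomial)
    also have "\<dots> = complex_of_real (((norm w)\<^sup>2) ^ n)" by (simp add: dinner_self)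
    finally have "(\<Sum>\<alpha> | length \<alpha> = n. (cmod (word_monomial w \<alpha>))\<^sup>2) = ((norm w)\<^sup>2) ^ n"
      by (simp only: of_real_eq_iff)
    then show ?thesis by (simp add: norm_scaleC power_mult_distrib sum_distrib_right[symmetric])
  qed
  have "(\<lambda>\<alpha>. (norm (cnj (word_monomial w \<alpha>) *\<^sub>C y))\<^sup>2) summable_on UNIV"
  proof (rule square_summable_words)
    fix N
    have "(\<Sum>n<N. ((norm w)\<^sup>2) ^ n) \<le> (\<Sum>n. ((norm w)\<^sup>2) ^ n)"
      using norm_w by (intro sum_le_suminf summable_geometric) auto
    then show "(\<Sum>n<N. \<Sum>\<alpha> | length \<alpha> = n. (norm (cnj (word_monomial w \<alpha>) *\<^sub>C y))\<^sup>2)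
        \<le> (\<Sum>n. ((norm w)\<^sup>2) ^ n) * (norm y)\<^sup>2"
      unfolding * sum_distrib_right[symmetric] by (rule mult_right_mono) simp
  qed
  then show ?thesis by (simp add: fock_kernel_def Abs_ell2_inverse)
qed

lemma cinner_fock_kernel_sums:
  assumes "z \<in> Bd"
  shows "(\<lambda>n. \<Sum>\<alpha> | length \<alpha> = n. word_monomial z \<alpha> * cinner (ell2_nth v \<alpha>) y) sums cinner v (fock_kernel z y)"
  using has_sum_words_sums[OF ell2_cinner_has_sum[of v "fock_kernel z y"]]
  by (simp add: fock_kernel_nth assms cinner_scaleC_right)

text \<open>Words of length \<open>n\<close> contribute \<open>dinner z w ^ n\<close>, and the
  geometric series over \<open>n\<close> is \<open>kd z w\<close>.\<close>

interpretation fock: kernel_feature kdI Bd fock_kernel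
proof
  fix z w :: "complex ^ 'a" and y y' :: 'b
  assume zw: "z \<in> Bd" "w \<in> Bd"
  have "(\<lambda>n. dinner z w ^ n * cinner y y') sums cinner (fock_kernel w y) (fock_kernel z y')"
    using cinner_fock_kernel_sums[OF zw(1), of "fock_kernel w y" y']
    by (simp add: fock_kernel_nth zw cinner_scaleC_left sum_word_monomial[symmetric] sum_distrib_left mult_ac)
  moreover have "(\<lambda>n. dinner z w ^ n * cinner y y') sums (1 / (1 - dinner z w) * cinner y y')"
    by (intro sums_mult2 geometric_sums cmod_dinner_less_1 zw)
  ultimately have "cinner (fock_kernel w y) (fock_kernel z y') = 1 / (1 - dinner z w) * cinner y y'"
    by (rule sums_unique2)
  then show "cinner (kdI z w y) y' = cinner (fock_kernel w y) (fock_kernel z y')"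
    by (simp add: kdI_def kd_def cinner_scaleC_left)
next
  fix z :: "complex ^ 'a" and c and y :: 'b
  assume "z \<in> Bd"
  then show "fock_kernel z (c *\<^sub>C y) = c *\<^sub>C fock_kernel z y"
    by (intro ell2_eqI) (simp add: fock_kernel_nth scaleC_scaleC mult.commute)
qed

text \<open>Left creation operator of the Fock space; its adjoint strips a leading \<open>j\<close>
  and is the backward shift.\<close>

definition creation :: "'d \<Rightarrow> ('d list, 'y::complex_inner) ell2 \<Rightarrow> ('d list, 'y) ell2" where
  "creation j h = Abs_ell2 (\<lambda>\<alpha>. if \<alpha> \<in> range (Cons j) then ell2_nth h (tl \<alpha>) else 0)"

lemma creation_nth:
  "ell2_nth (creation j h) \<alpha> = (if \<alpha> \<in> range (Cons j) then ell2_nth h (tl \<alpha>) else 0)"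
proof -
  let ?f = "\<lambda>\<alpha>. if \<alpha> \<in> range (Cons j) then ell2_nth h (tl \<alpha>) else 0"
  have "(\<lambda>\<alpha>. (norm (?f \<alpha>))\<^sup>2) summable_on range (Cons j)"
    by (subst summable_on_reindex) (simp_all add: comp_def ell2_summable)
  then have "(\<lambda>\<alpha>. (norm (?f \<alpha>))\<^sup>2) summable_on UNIV"
    by (rule summable_on_cong_neutral[THEN iffD1, rotated -1]) auto
  then show ?thesis by (simp add: creation_def Abs_ell2_inverse)
qed

text \<open>The backward shift of \<open>x\<close> enters as a given vector \<open>x'\<close>,
  because in the application it is already known: the coefficient family of
  \<open>A j x\<close>.\<close>

lemma cinner_creation:
  assumes "\<And>\<alpha>. ell2_nth x' \<alpha> = ell2_nth x (j # \<alpha>)"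
  shows "cinner (creation j h) x = cinner h x'"
proof -
  let ?f = "\<lambda>\<alpha>. cinner (ell2_nth (creation j h) \<alpha>) (ell2_nth x \<alpha>)"
  have "(?f has_sum cinner (creation j h) x) UNIV" by (rule ell2_cinner_has_sum)
  then have "(?f has_sum cinner (creation j h) x) (range (Cons j))"
    by (rule has_sum_cong_neutral[THEN iffD1, rotated -1]) (auto simp: creation_nth)
  then have "(?f \<circ> Cons j has_sum cinner (creation j h) x) UNIV"
    by (subst (asm) has_sum_reindex) simp_all
  then have "((\<lambda>\<alpha>. cinner (ell2_nth h \<alpha>) (ell2_nth x' \<alpha>)) has_sum cinner (creation j h) x) UNIV"
    by (simp add: comp_def creation_nth assms)
  then show ?thesis using ell2_cinner_has_sum[of h x'] has_sum_unique by blast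
qed

text \<open>Kernel vectors are eigenvectors of the backward shift, with eigenvalue
  \<open>cnj (z $ j)\<close>. Prefixing a letter destroys symmetry, so no minimality is
  claimed.\<close>

lemma represents_creation:
  assumes "fock.represents x h"
  shows "fock.represents (creation j x) (\<lambda>z. (z $ j) *\<^sub>C h z)"
proof -
  have "cinner (creation j x) (fock_kernel z y) = cinner x (cnj (z $ j) *\<^sub>C fock_kernel z y)" if "z \<in> Bd" for z y
    by (rule cinner_creation) (simp add: fock_kernel_nth that scaleC_scaleC)
  then show ?thesis
    using assms by (simp add: fock.represents_def cinner_scaleC_left cinner_scaleC_right)
qed

section \<open>Separating words by their multisets of letters\<close>

text \<open>Once the coefficients below \<open>n\<close> vanish, the series can be divided by
  \<open>t ^ n\<close>; its constant term is then the limit at 0 of a function that vanishes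
  elsewhere in the disc.\<close>

lemma powser_sums_zero_coeffs:
  fixes a :: "nat \<Rightarrow> complex"
  assumes "\<And>t. cmod t < 1 \<Longrightarrow> (\<lambda>n. a n * t ^ n) sums 0"
  shows "a n = 0"
proof (induction n rule: less_induct)
  case (less n)
  have "((\<lambda>_. 0) \<longlongrightarrow> a (0 + n)) (at (0::complex))"
  proof (rule powser_limit_0_strong[where s=1 and a="\<lambda>k. a (k + n)"])
    fix t :: complex assume t: "t \<noteq> 0" "cmod t < 1"
    have "(\<lambda>k. a (k + n) * t ^ (k + n)) sums (0 - (\<Sum>i<n. a i * t ^ i))"
      by (rule sums_split_initial_segment) (use assms t in auto)
    then have "(\<lambda>k. t ^ n * (a (k + n) * t ^ k)) sums (t ^ n * 0)"
      using less by (simp add: power_add mult_ac)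
    then show "(\<lambda>k. a (k + n) * t ^ k) sums 0"
      using t by (subst (asm) sums_mult_iff) simp_all
  qed simp
  then show ?case by (simp add: tendsto_const_iff)
qed

text \<open>Positional notation in base \<open>Suc n\<close>: values up to \<open>n\<close> are
  digits, so the weighted sum determines all of them.\<close>

lemma separating_weights:
  assumes "finite I"
  shows "\<exists>k :: 'a \<Rightarrow> nat. \<forall>a b. (\<forall>j\<in>I. a j \<le> n \<and> b j \<le> n) \<longrightarrow>
    (\<Sum>j\<in>I. a j * k j) = (\<Sum>j\<in>I. b j * k j) \<longrightarrow> (\<forall>j\<in>I. a j = b j)"
  using assms
proof (induction I)
  case (insert x I)
  then obtain k where k: "\<And>a b. (\<forall>j\<in>I. a j \<le> n \<and> b j \<le> n) \<Longrightarrow>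
    (\<Sum>j\<in>I. a j * k j) = (\<Sum>j\<in>I. b j * k j) \<Longrightarrow> (\<forall>j\<in>I. a j = b j)" by blast
  \<comment> \<open>The new element takes the units digit and the old weights move up one place, so
    \<open>a x\<close> is the remainder modulo \<open>Suc n\<close>.\<close>
  define k' where "k' = (\<lambda>j. if j = x then 1 else Suc n * k j)"
  have sum: "(\<Sum>j\<in>insert x I. a j * k' j) = a x + Suc n * (\<Sum>j\<in>I. a j * k j)" for a
  proof -
    have "(\<Sum>j\<in>I. a j * k' j) = (\<Sum>j\<in>I. Suc n * (a j * k j))"
      using insert by (intro sum.cong) (auto simp: k'_def algebra_simps)
    then show ?thesis using insert by (simp add: k'_def sum_distrib_left)
  qed
  have "\<forall>j\<in>insert x I. a j = b j"
    if "\<forall>j\<in>insert x I. a j \<le> n \<and> b j \<le> n" "(\<Sum>j\<in>insert x I. a j * k' j) = (\<Sum>j\<in>insert x I. b j * k' j)" for a b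
  proof -
    have eq: "a x + Suc n * (\<Sum>j\<in>I. a j * k j) = b x + Suc n * (\<Sum>j\<in>I. b j * k j)"
      using that(2) unfolding sum .
    have "a x mod Suc n = b x mod Suc n" using arg_cong[OF eq, of "\<lambda>u. u mod Suc n"] by (simp del: mult_Suc)
    then have x: "a x = b x" using that(1) by (simp add: le_imp_less_Suc)
    then have "(\<Sum>j\<in>I. a j * k j) = (\<Sum>j\<in>I. b j * k j)" using eq by (simp del: mult_Suc)
    then have "\<forall>j\<in>I. a j = b j" using that(1) by (intro k) auto
    then show ?thesis using x by simp
  qed
  then show ?case by blast
qed simp

lemma sum_list_weights:
  "sum_list (map k \<alpha>) = (\<Sum>j\<in>UNIV. count (mset \<alpha>) j * k j)" for \<alpha> :: "'d::finite list" and k :: "'d \<Rightarrow> nat"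
proof (induction \<alpha>)
  case (Cons i \<alpha>)
  have "(\<Sum>j\<in>UNIV. count (mset (i # \<alpha>)) j * k j)
      = (\<Sum>j\<in>UNIV. (if j = i then k j else 0) + count (mset \<alpha>) j * k j)"
    by (rule sum.cong) auto
  then show ?case by (simp add: Cons sum.distrib)
qed simp

text \<open>The vectors orthogonal to all \<open>fock_kernel z y\<close> are those whose generating function
  \<open>\<Sum>\<alpha>. z\<^sup>\<alpha> v\<^sub>\<alpha>\<close> vanishes on the ball. Homogeneity separates the word lengths; within
  one length, the Kronecker substitution \<open>z $ j = r * t ^ k j\<close> separates the multisets of letters,
  so the sum of \<open>v\<close> over each class of anagrams is zero.\<close>

lemma minimal_symmetric:
  fixes s :: "('d::finite list, 'y::chilbert) ell2"
  assumes symm: "\<And>\<alpha> \<beta>. mset \<alpha> = mset \<beta> \<Longrightarrow> ell2_nth s \<alpha> = ell2_nth s \<beta>"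
  shows "fock.minimal s"
  unfolding fock.minimal_def
proof (intro allI impI)
  fix v :: "('d list, 'y) ell2"
  assume v: "\<forall>z\<in>Bd. \<forall>y. cinner v (fock_kernel z y) = 0"
  have hom: "(\<Sum>\<alpha> | length \<alpha> = n. word_monomial z \<alpha> * cinner (ell2_nth v \<alpha>) y) = 0"
    if z: "z \<in> Bd" for z n y
  proof (rule powser_sums_zero_coeffs)
    fix t :: complex assume t: "cmod t < 1"
    have "norm (t *s z) = cmod t * norm z"
      by (simp add: norm_vec_def norm_mult L2_set_right_distrib)
    also have "\<dots> \<le> 1 * norm z" using t by (intro mult_right_mono) auto
    finally have "t *s z \<in> Bd" using z by (simp add: mem_Bd_iff)
    then have "(\<lambda>n. \<Sum>\<alpha> | length \<alpha> = n. word_monomial (t *s z) \<alpha> * cinner (ell2_nth v \<alpha>) y) sums 0"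
      using cinner_fock_kernel_sums[of "t *s z" v y] v by simp
    then show "(\<lambda>n. (\<Sum>\<alpha> | length \<alpha> = n. word_monomial z \<alpha> * cinner (ell2_nth v \<alpha>) y) * t ^ n) sums 0"
      by (simp add: word_monomial_scale sum_distrib_right sum_distrib_left mult_ac)
  qed
  have level: "(\<Sum>\<alpha> | length \<alpha> = n. cinner (ell2_nth v \<alpha>) (ell2_nth s \<alpha>)) = 0" for n
  proof -
    \<comment> \<open>The digits will be letter counts, which cannot exceed the word length
      \<open>n\<close>.\<close>
    obtain k :: "'d \<Rightarrow> nat" where k: "\<And>a b. (\<forall>j. a j \<le> n \<and> b j \<le> n) \<Longrightarrow>
        (\<Sum>j\<in>UNIV. a j * k j) = (\<Sum>j\<in>UNIV. b j * k j) \<Longrightarrow> (\<forall>j. a j = b j)"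
      using separating_weights[of "UNIV :: 'd set" n] by auto
    define \<kappa> where "\<kappa> = (\<lambda>\<alpha>. sum_list (map k \<alpha>))"
    let ?W = "{\<alpha> :: 'd list. length \<alpha> = n}"
    have anagram: "mset \<alpha> = mset \<beta>" if "length \<alpha> = n" "length \<beta> = n" "\<kappa> \<alpha> = \<kappa> \<beta>" for \<alpha> \<beta>
    proof -
      have "\<forall>j. count (mset \<alpha>) j \<le> n \<and> count (mset \<beta>) j \<le> n"
        using that count_le_size[of "mset \<alpha>"] count_le_size[of "mset \<beta>"] by simp
      then have "\<forall>j. count (mset \<alpha>) j = count (mset \<beta>) j"
        using that(3) unfolding \<kappa>_def sum_list_weights by (rule k)
      then show ?thesis by (simp add: multiset_eq_iff)
    qed
    \<comment> \<open>Chosen so that the points with coordinates \<open>r * t ^ k j\<close> stay in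
      the ball: their norm is at most \<open>CARD('d) * r < 1\<close>.\<close>
    define r :: real where "r = 1 / (1 + real CARD('d))"
    have r: "0 < r" "real CARD('d) * r < 1" by (auto simp: r_def field_simps)
    have class_sum: "(\<Sum>\<alpha> | \<alpha> \<in> ?W \<and> \<kappa> \<alpha> = i. cinner (ell2_nth v \<alpha>) y) = 0" for i y
    proof (rule powser_sums_zero_coeffs)
      fix t :: complex assume t: "cmod t < 1"
      define z :: "complex ^ 'd" where "z = (\<chi> j. r * t ^ k j)"
      have "norm z \<le> (\<Sum>j\<in>UNIV. norm (z $ j))"
        unfolding norm_vec_def by (rule L2_set_le_sum) simp
      also have "\<dots> \<le> (\<Sum>j\<in>(UNIV :: 'd set). r)"
        using r t by (intro sum_mono) (simp add: z_def norm_mult norm_power power_le_one mult_left_le)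
      also have "\<dots> < 1" using r by simp
      finally have z: "z \<in> Bd" by (simp add: mem_Bd_iff)
      have wm: "word_monomial z \<alpha> = r ^ length \<alpha> * t ^ \<kappa> \<alpha>" for \<alpha>
        by (induction \<alpha>) (simp_all add: z_def \<kappa>_def power_add mult_ac)
      have "complex_of_real r ^ n * (\<Sum>\<alpha>\<in>?W. t ^ \<kappa> \<alpha> * cinner (ell2_nth v \<alpha>) y) = 0"
        using hom[OF z, where n=n and y=y] by (simp add: wm sum_distrib_left mult_ac)
      then have 0: "(\<Sum>\<alpha>\<in>?W. t ^ \<kappa> \<alpha> * cinner (ell2_nth v \<alpha>) y) = 0" using r by simp
      have "(\<lambda>i. (\<Sum>\<alpha> | \<alpha> \<in> ?W \<and> \<kappa> \<alpha> = i. cinner (ell2_nth v \<alpha>) y) * t ^ i) sums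
          (\<Sum>i\<in>\<kappa> ` ?W. (\<Sum>\<alpha> | \<alpha> \<in> ?W \<and> \<kappa> \<alpha> = i. cinner (ell2_nth v \<alpha>) y) * t ^ i)"
      proof (rule sums_finite)
        fix i assume "i \<notin> \<kappa> ` ?W"
        then have "{\<alpha>. \<alpha> \<in> ?W \<and> \<kappa> \<alpha> = i} = {}" by auto
        then show "(\<Sum>\<alpha> | \<alpha> \<in> ?W \<and> \<kappa> \<alpha> = i. cinner (ell2_nth v \<alpha>) y) * t ^ i = 0"
          by (simp only: sum.empty mult_zero_left)
      qed simp
      also have "(\<Sum>i\<in>\<kappa> ` ?W. (\<Sum>\<alpha> | \<alpha> \<in> ?W \<and> \<kappa> \<alpha> = i. cinner (ell2_nth v \<alpha>) y) * t ^ i)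
          = (\<Sum>i\<in>\<kappa> ` ?W. \<Sum>\<alpha> | \<alpha> \<in> ?W \<and> \<kappa> \<alpha> = i. t ^ \<kappa> \<alpha> * cinner (ell2_nth v \<alpha>) y)"
        by (intro sum.cong refl) (simp add: sum_distrib_left mult.commute)
      also have "\<dots> = 0" using 0 sum.image_gen[of ?W "\<lambda>\<alpha>. t ^ \<kappa> \<alpha> * cinner (ell2_nth v \<alpha>) y" \<kappa>] by simp
      finally show "(\<lambda>i. (\<Sum>\<alpha> | \<alpha> \<in> ?W \<and> \<kappa> \<alpha> = i. cinner (ell2_nth v \<alpha>) y) * t ^ i) sums 0" .
    qed
    have "(\<Sum>\<alpha> | \<alpha> \<in> ?W \<and> \<kappa> \<alpha> = i. cinner (ell2_nth v \<alpha>) (ell2_nth s \<alpha>)) = 0" if "i \<in> \<kappa> ` ?W" for i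
    proof -
      \<comment> \<open>Equal weight means anagram, so \<open>s\<close> is constant on the class and
        \<open>class_sum\<close> applies with the fixed vector
        \<open>ell2_nth s \<beta>\<close>.\<close>
      obtain \<beta> where \<beta>: "length \<beta> = n" "i = \<kappa> \<beta>" using \<open>i \<in> \<kappa> ` ?W\<close> by auto
      have "(\<Sum>\<alpha> | \<alpha> \<in> ?W \<and> \<kappa> \<alpha> = i. cinner (ell2_nth v \<alpha>) (ell2_nth s \<alpha>))
          = (\<Sum>\<alpha> | \<alpha> \<in> ?W \<and> \<kappa> \<alpha> = i. cinner (ell2_nth v \<alpha>) (ell2_nth s \<beta>))"
        using \<beta> by (intro sum.cong refl arg_cong2[of _ _ _ _ cinner] symm anagram) auto
      then show ?thesis using class_sum by simp
    qed
    then show ?thesis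
      using sum.image_gen[of ?W "\<lambda>\<alpha>. cinner (ell2_nth v \<alpha>) (ell2_nth s \<alpha>)" \<kappa>] by simp
  qed
  have "(\<lambda>n. \<Sum>\<alpha> | length \<alpha> = n. cinner (ell2_nth v \<alpha>) (ell2_nth s \<alpha>)) sums cinner v s"
    by (intro has_sum_words_sums ell2_cinner_has_sum)
  then show "cinner v s = 0" by (simp add: level sums_unique2[OF _ sums_zero])
qed

text \<open>On representatives, multiplication by a coordinate is creation and its adjoint is the
  letter deletion in \<open>shift\<close>. As \<open>Mstar\<close> is a definite description, the
  adjoint identity must also be shown to have only one solution.\<close>

lemma Mstar_represents:
  fixes f g :: "complex ^ 'd::finite \<Rightarrow> 'y::chilbert"
  assumes f: "fock.represents s f" "fock.minimal s"
    and g: "fock.represents s' g" "fock.minimal s'"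
    and shift: "\<And>\<alpha>. ell2_nth s' \<alpha> = ell2_nth s (j # \<alpha>)"
  shows "Mstar j f = g"
  unfolding Mstar_def
proof (rule the_equality)
  have "rkhs_inner kdI Bd (\<lambda>z. (z $ j) *\<^sub>C h z) f = rkhs_inner kdI Bd h g" if h: "h \<in> rkhs kdI Bd" for h
  proof -
    obtain m where m: "fock.represents m h" using fock.rkhs_obtain[OF h] by blast
    have "rkhs_inner kdI Bd (\<lambda>z. (z $ j) *\<^sub>C h z) f = cinner (creation j m) s"
      by (intro fock.rkhs_inner_represents represents_creation m f)
    also have "\<dots> = cinner m s'" by (rule cinner_creation) (rule shift)
    also have "\<dots> = rkhs_inner kdI Bd h g" by (intro fock.rkhs_inner_represents[symmetric] m g)
    finally show ?thesis .
  qed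
  then show "g \<in> rkhs kdI Bd \<and>
      (\<forall>h\<in>rkhs kdI Bd. rkhs_inner kdI Bd (\<lambda>z. (z $ j) *\<^sub>C h z) f = rkhs_inner kdI Bd h g)"
    using fock.rkhs_represents[OF g(1)] by simp
  fix g' :: "complex ^ 'd \<Rightarrow> 'y"
  assume g': "g' \<in> rkhs kdI Bd \<and>
      (\<forall>h\<in>rkhs kdI Bd. rkhs_inner kdI Bd (\<lambda>z. (z $ j) *\<^sub>C h z) f = rkhs_inner kdI Bd h g')"
  then obtain m where m: "fock.represents m g'" "fock.minimal m" using fock.rkhs_obtain by blast
  have diff: "fock.represents (m + (-1) *\<^sub>C s') (\<lambda>z. g' z + (-1) *\<^sub>C g z)"
    by (intro fock.represents_linear m g)
  \<comment> \<open>Testing both adjoint identities on the difference of the two candidates gives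
    \<open>norm (m - s') = 0\<close>.\<close>
  define h where "h = (\<lambda>z. g' z + (-1) *\<^sub>C g z)"
  have h: "h \<in> rkhs kdI Bd" using fock.rkhs_represents[OF diff] by (simp add: h_def)
  have "cinner (m + (-1) *\<^sub>C s') m = rkhs_inner kdI Bd h g'"
    unfolding h_def by (rule fock.rkhs_inner_represents[symmetric, OF diff m])
  also have "\<dots> = rkhs_inner kdI Bd h g" using g' h
    \<open>\<And>h. h \<in> rkhs kdI Bd \<Longrightarrow> rkhs_inner kdI Bd (\<lambda>z. (z $ j) *\<^sub>C h z) f = rkhs_inner kdI Bd h g\<close> by metis
  also have "\<dots> = cinner (m + (-1) *\<^sub>C s') s'"
    unfolding h_def by (rule fock.rkhs_inner_represents[OF diff g])
  finally have "cinner (m - s') (m - s') = 0" by (simp add: scaleC_one cinner_diff_right)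
  then have "m = s'" by (simp add: cinner_eq_zero_iff)
  then show "g' = g" using m(1) g(1) fock.represents_unique by blast
qed

section \<open>The observability map of a realization\<close>

lemma cadjoint_linear:
  fixes T :: "'a::chilbert \<Rightarrow> 'b::complex_inner"
  assumes "bounded_clinear T"
  shows "cadjoint T (x + c *\<^sub>C y) = cadjoint T x + c *\<^sub>C cadjoint T y"
  by (rule cinner_ext_right) (simp add: cinner_cadjoint assms cinner_add_right cinner_scaleC_right)

lemma cadjoint_scaleC:
  fixes T :: "'a::chilbert \<Rightarrow> 'b::complex_inner"
  assumes "bounded_clinear T"
  shows "cadjoint T (c *\<^sub>C y) = c *\<^sub>C cadjoint T y"
  by (rule cinner_ext_right) (simp add: cinner_cadjoint assms cinner_scaleC_right)

locale weakly_coisometric_realization =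
  fixes S :: "complex ^ 'd::finite \<Rightarrow> ('u::chilbert \<Rightarrow>\<^sub>L 'y::chilbert)"
    and A :: "'d \<Rightarrow> 'x::chilbert \<Rightarrow> 'x"
    and B :: "'d \<Rightarrow> 'u \<Rightarrow> 'x"
    and C :: "'x \<Rightarrow> 'y"
    and D :: "'u \<Rightarrow> 'y"
  assumes realization: "is_realization S A B C D"
    and comm: "commutative A"
    and observ: "observable A C"
    and weak_coisometry: "weakly_coisometric A B C D"
begin

lemma clinear_A: "bounded_clinear (A j)" and clinear_B: "bounded_clinear (B j)"
  and clinear_C: "bounded_clinear C" and clinear_D: "bounded_clinear D"
  using realization by (auto simp: is_realization_def)

lemmas A_add = linear_add[OF bounded_clinear_linear[OF clinear_A]]
lemmas C_add = linear_add[OF bounded_clinear_linear[OF clinear_C]]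
lemmas C_scaleC = bounded_clinear_scaleC[OF clinear_C]
lemmas A_scaleC = bounded_clinear_scaleC[OF clinear_A]
lemmas A_zero = linear_0[OF bounded_clinear_linear[OF clinear_A]]
lemmas B_zero = linear_0[OF bounded_clinear_linear[OF clinear_B]]
lemmas C_zero = linear_0[OF bounded_clinear_linear[OF clinear_C]]
lemmas D_zero = linear_0[OF bounded_clinear_linear[OF clinear_D]]

lemma contraction_AC: "(\<Sum>j\<in>UNIV. (norm (A j x))\<^sup>2) + (norm (C x))\<^sup>2 \<le> (norm x)\<^sup>2"
proof -
  have "contractive_conn A B C D" using weak_coisometry by (simp add: weakly_coisometric_def)
  then have "(\<Sum>j\<in>UNIV. (norm (A j x + B j 0))\<^sup>2) + (norm (C x + D 0))\<^sup>2 \<le> (norm x)\<^sup>2 + (norm (0::'u))\<^sup>2"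
    unfolding contractive_conn_def by blast
  then show ?thesis by (simp add: B_zero D_zero)
qed

definition ZA :: "complex ^ 'd \<Rightarrow> 'x \<Rightarrow> 'x" where
  "ZA z x = (\<Sum>j\<in>UNIV. (z $ j) *\<^sub>C A j x)"

lemma IZA_eq: "IZA z A x = x - ZA z x"
  by (simp add: IZA_def ZA_def)

lemma ZA_add: "ZA z (x + y) = ZA z x + ZA z y"
  by (simp add: ZA_def A_add scaleC_add_right sum.distrib)

lemma ZA_scaleC: "ZA z (c *\<^sub>C x) = c *\<^sub>C ZA z x"
  by (simp add: ZA_def A_scaleC scaleC_sum_right scaleC_scaleC mult.commute)

lemma ZA_pow_add: "(ZA z ^^ n) (x + y) = (ZA z ^^ n) x + (ZA z ^^ n) y"
  by (induction n) (simp_all add: ZA_add)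

lemma ZA_pow_scaleC: "(ZA z ^^ n) (c *\<^sub>C x) = c *\<^sub>C (ZA z ^^ n) x"
  by (induction n) (simp_all add: ZA_scaleC)

lemma ZA_pow_sum: "finite I \<Longrightarrow> (ZA z ^^ n) (\<Sum>i\<in>I. f i) = (\<Sum>i\<in>I. (ZA z ^^ n) (f i))"
proof (induction I rule: finite_induct)
  case empty
  show ?case using ZA_pow_scaleC[of n z 0 0] by simp
qed (simp add: ZA_pow_add)

text \<open>Cauchy-Schwarz for the row \<open>z\<close> against the column of the
  \<open>A j\<close>, a contraction by \<open>contraction_AC\<close>. With \<open>norm z < 1\<close>
  it yields both the resolvent bound and the Neumann series.\<close>

lemma norm_ZA_le: "norm (ZA z x) \<le> norm z * norm x"
proof -
  have "norm (ZA z x) \<le> (\<Sum>j\<in>UNIV. \<bar>norm (z $ j)\<bar> * \<bar>norm (A j x)\<bar>)"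
    unfolding ZA_def by (rule order_trans[OF norm_sum]) (simp add: norm_scaleC)
  also have "\<dots> \<le> norm z * L2_set (\<lambda>j. norm (A j x)) UNIV"
    unfolding norm_vec_def by (rule L2_set_mult_ineq)
  also have "L2_set (\<lambda>j. norm (A j x)) UNIV \<le> norm x"
    unfolding L2_set_def using contraction_AC[of x] zero_le_power2[of "norm (C x)"]
    by (intro real_le_lsqrt norm_ge_zero) linarith
  finally show ?thesis by (simp add: mult_left_mono)
qed

lemma norm_ZA_pow_le: "norm ((ZA z ^^ n) x) \<le> norm z ^ n * norm x"
proof (induction n)
  case (Suc n)
  have "norm ((ZA z ^^ Suc n) x) \<le> norm z * norm ((ZA z ^^ n) x)" using norm_ZA_le by simp
  also have "\<dots> \<le> norm z * (norm z ^ n * norm x)" by (intro mult_left_mono Suc) simp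
  finally show ?case by (simp add: mult_ac)
qed simp

definition resolvent :: "complex ^ 'd \<Rightarrow> 'x \<Rightarrow> 'x" where
  "resolvent z = inv (IZA z A)"

lemma IZA_resolvent: "z \<in> Bd \<Longrightarrow> IZA z A (resolvent z x) = x"
  and resolvent_IZA: "z \<in> Bd \<Longrightarrow> resolvent z (IZA z A x) = x"
  using realization by (auto simp: is_realization_def resolvent_def bij_is_surj bij_is_inj surj_f_inv_f inv_f_f)

lemma S_eq: "z \<in> Bd \<Longrightarrow> blinfun_apply (S z) u = D u + C (resolvent z (\<Sum>j\<in>UNIV. (z $ j) *\<^sub>C B j u))"
  using realization by (simp add: is_realization_def resolvent_def)

lemma resolvent_eqI: "z \<in> Bd \<Longrightarrow> IZA z A y = x \<Longrightarrow> resolvent z x = y"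
  using resolvent_IZA by blast

text \<open>A realization only postulates that \<open>IZA z A\<close> is bijective: linearity of the
  inverse comes from uniqueness of preimages, its bound from \<open>norm_ZA_le\<close>.\<close>

lemma clinear_resolvent:
  assumes z: "z \<in> Bd"
  shows "bounded_clinear (resolvent z)"
proof (rule bounded_clinearI)
  note r = IZA_resolvent[OF z, unfolded IZA_eq]
  show "resolvent z (x + y) = resolvent z x + resolvent z y" for x y
  proof (rule resolvent_eqI[OF z])
    have "IZA z A (resolvent z x + resolvent z y)
        = (resolvent z x - ZA z (resolvent z x)) + (resolvent z y - ZA z (resolvent z y))"
      by (simp add: IZA_eq ZA_add algebra_simps)
    then show "IZA z A (resolvent z x + resolvent z y) = x + y" by (simp only: r)
  qed
  show "resolvent z (c *\<^sub>C x) = c *\<^sub>C resolvent z x" for c x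
    by (rule resolvent_eqI[OF z]) (simp add: IZA_eq ZA_scaleC scaleC_diff_right[symmetric] r)
  have "(1 - norm z) * norm (resolvent z x) \<le> norm x" for x
  proof -
    have "norm (resolvent z x) \<le> norm (resolvent z x - ZA z (resolvent z x)) + norm (ZA z (resolvent z x))"
      using norm_triangle_ineq[of "resolvent z x - ZA z (resolvent z x)" "ZA z (resolvent z x)"] by simp
    also have "\<dots> \<le> norm x + norm z * norm (resolvent z x)"
      unfolding r by (intro add_left_mono norm_ZA_le)
    finally show ?thesis by (simp add: algebra_simps)
  qed
  then show "norm (resolvent z x) \<le> norm x * (1 / (1 - norm z))" for x
    using z by (simp add: mem_Bd_iff field_simps)
qed

definition adjoint_IZA :: "complex ^ 'd \<Rightarrow> 'x \<Rightarrow> 'x" where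
  "adjoint_IZA z x = x - (\<Sum>i\<in>UNIV. cnj (z $ i) *\<^sub>C cadjoint (A i) x)"

lemma cinner_adjoint_IZA: "cinner x (adjoint_IZA z v) = cinner (IZA z A x) v"
  by (simp add: adjoint_IZA_def IZA_eq ZA_def cinner_diff_left cinner_diff_right cinner_sum_left
      cinner_sum_right cinner_scaleC_left cinner_scaleC_right cinner_cadjoint[OF clinear_A])

text \<open>Written with \<open>inv\<close> to agree with the generators in \<open>Dgen\<close>;
  \<open>feature_eq\<close> gives the form used in computations.\<close>

definition feature :: "complex ^ 'd \<Rightarrow> 'y \<Rightarrow> 'x" where
  "feature z y = inv (adjoint_IZA z) (cadjoint C y)"

text \<open>Surjectivity of \<open>IZA z A\<close> makes its adjoint injective, so
  \<open>inv\<close> returns the one preimage, which the adjoint of the resolvent provides.\<close>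

lemma feature_eq:
  assumes z: "z \<in> Bd"
  shows "feature z y = cadjoint (resolvent z) (cadjoint C y)"
proof -
  have "inj (adjoint_IZA z)"
  proof (rule injI)
    fix v v' assume eq: "adjoint_IZA z v = adjoint_IZA z v'"
    have "cinner x v = cinner x v'" for x
      using cinner_adjoint_IZA[of "resolvent z x" z v] cinner_adjoint_IZA[of "resolvent z x" z v']
      by (simp add: eq IZA_resolvent[OF z])
    then show "v = v'" by (rule cinner_ext_right)
  qed
  moreover have "adjoint_IZA z (cadjoint (resolvent z) (cadjoint C y)) = cadjoint C y"
    by (rule cinner_ext_right)
       (simp add: cinner_adjoint_IZA cinner_cadjoint[OF clinear_resolvent[OF z]] resolvent_IZA[OF z])
  ultimately show ?thesis unfolding feature_def by (rule inv_f_eq)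
qed

lemma cinner_feature:
  assumes "z \<in> Bd"
  shows "cinner x (feature z y) = cinner (C (resolvent z x)) y"
  by (simp add: feature_eq assms cinner_cadjoint[OF clinear_resolvent[OF assms]] cinner_cadjoint[OF clinear_C])

lemma adjoint_IZA_feature:
  assumes "z \<in> Bd"
  shows "adjoint_IZA z (feature z y) = cadjoint C y"
  by (rule cinner_ext_right)
     (simp add: cinner_adjoint_IZA cinner_feature assms resolvent_IZA cinner_cadjoint[OF clinear_C])

section \<open>Weak coisometry as a factorization of the kernel \<open>KS S\<close>\<close>

definition Dvec :: "complex ^ 'd \<Rightarrow> 'y \<Rightarrow> 'd \<Rightarrow> 'x" where
  "Dvec z y = (\<lambda>j. cnj (z $ j) *\<^sub>C feature z y)"

text \<open>Lower component of the adjoint connecting operator at \<open>(Dvec z y, y)\<close>; by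
  \<open>cadjoint_S\<close> it is the adjoint of \<open>S z\<close> at \<open>y\<close> when
  \<open>z\<close> is in \<open>Bd\<close>.\<close>

definition Sadj :: "complex ^ 'd \<Rightarrow> 'y \<Rightarrow> 'u" where
  "Sadj z y = (\<Sum>j\<in>UNIV. cadjoint (B j) (Dvec z y j)) + cadjoint D y"

lemma cinner_Sadj:
  assumes "z \<in> Bd"
  shows "cinner u (Sadj z y) = cinner (blinfun_apply (S z) u) y"
proof -
  have "cinner (C (resolvent z (\<Sum>j\<in>UNIV. (z $ j) *\<^sub>C B j u))) y
      = cinner (\<Sum>j\<in>UNIV. (z $ j) *\<^sub>C B j u) (feature z y)"
    by (simp add: cinner_feature assms)
  then show ?thesis
    by (simp add: S_eq assms Sadj_def Dvec_def cinner_add_left cinner_add_right cinner_sum_left cinner_sum_right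
        cinner_cadjoint[OF clinear_D] cinner_cadjoint[OF clinear_B] cinner_scaleC_left cinner_scaleC_right add.commute)
qed

lemma cadjoint_S: "z \<in> Bd \<Longrightarrow> cadjoint (blinfun_apply (S z)) y = Sadj z y"
  by (rule cadjoint_eqI) (simp add: cinner_Sadj)

text \<open>Upper component at the same vector: the equation defining \<open>feature\<close>,
  rearranged.\<close>

lemma sum_cadjoint_A_Dvec:
  assumes "z \<in> Bd"
  shows "(\<Sum>j\<in>UNIV. cadjoint (A j) (Dvec z y j)) + cadjoint C y = feature z y"
  using adjoint_IZA_feature[OF assms, of y]
  by (simp add: adjoint_IZA_def Dvec_def cadjoint_scaleC[OF clinear_A] algebra_simps)

lemma Dvec_combination_mem:
  assumes "z \<in> Bd" "w \<in> Bd"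
  shows "(\<lambda>j. Dvec w y j + c *\<^sub>C Dvec z y' j) \<in> Dspace A C"
proof -
  have gen: "Dvec z y \<in> Dgen A C" if "z \<in> Bd" for z y
    using that by (auto simp: Dgen_def Dvec_def feature_def adjoint_IZA_def[abs_def])
  have "(\<lambda>j. Dvec w y j + c *\<^sub>C Dvec z y' j) \<in> cspan_t (Dgen A C)"
    unfolding cspan_t_def
    using gen assms
    by (auto intro!: exI[of _ "2::nat"] exI[of _ "\<lambda>i. if i = 0 then 1 else c"]
        exI[of _ "\<lambda>i. if i = 0 then Dvec w y else Dvec z y'"] simp: numeral_2_eq_2 scaleC_one)
  then show ?thesis
    unfolding Dspace_def
    by (auto intro!: exI[of _ "\<lambda>_ j. Dvec w y j + c *\<^sub>C Dvec z y' j"] simp: tnorm_def)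
qed

lemma weak_coisometry_eq:
  assumes "z \<in> Bd" "w \<in> Bd"
  shows "(norm (feature w y + c *\<^sub>C feature z y'))\<^sup>2 + (norm (Sadj w y + c *\<^sub>C Sadj z y'))\<^sup>2
    = (\<Sum>j\<in>UNIV. (norm (Dvec w y j + c *\<^sub>C Dvec z y' j))\<^sup>2) + (norm (y + c *\<^sub>C y'))\<^sup>2"
proof -
  let ?t = "\<lambda>j. Dvec w y j + c *\<^sub>C Dvec z y' j"
  have A: "(\<Sum>j\<in>UNIV. cadjoint (A j) (?t j)) + cadjoint C (y + c *\<^sub>C y') = feature w y + c *\<^sub>C feature z y'"
    unfolding sum_cadjoint_A_Dvec[OF assms(1), symmetric] sum_cadjoint_A_Dvec[OF assms(2), symmetric]
    by (simp add: cadjoint_linear[OF clinear_A] cadjoint_linear[OF clinear_C] sum.distrib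
        scaleC_add_right scaleC_sum_right)
  have B: "(\<Sum>j\<in>UNIV. cadjoint (B j) (?t j)) + cadjoint D (y + c *\<^sub>C y') = Sadj w y + c *\<^sub>C Sadj z y'"
    by (simp add: Sadj_def cadjoint_linear[OF clinear_B] cadjoint_linear[OF clinear_D] sum.distrib
        scaleC_add_right scaleC_sum_right)
  have "(norm ((\<Sum>j\<in>UNIV. cadjoint (A j) (?t j)) + cadjoint C (y + c *\<^sub>C y')))\<^sup>2
      + (norm ((\<Sum>j\<in>UNIV. cadjoint (B j) (?t j)) + cadjoint D (y + c *\<^sub>C y')))\<^sup>2
      = (tnorm ?t)\<^sup>2 + (norm (y + c *\<^sub>C y'))\<^sup>2"
    using weak_coisometry Dvec_combination_mem[OF assms] by (simp add: weakly_coisometric_def)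
  then show ?thesis unfolding A B by (simp add: tnorm_def sum_nonneg)
qed

text \<open>Polarized weak coisometry; the factor \<open>dinner z w\<close> comes from the scalars
  \<open>cnj (z $ j)\<close> and \<open>cnj (w $ j)\<close> in \<open>Dvec\<close>.\<close>

lemma kernel_identity:
  assumes zw: "z \<in> Bd" "w \<in> Bd"
  shows "(1 - dinner z w) * cinner (feature w y) (feature z y') = cinner y y' - cinner (Sadj w y) (Sadj z y')"
proof -
  define E where "E = cinner (feature w y) (feature z y') + cinner (Sadj w y) (Sadj z y')
      - (\<Sum>j\<in>UNIV. cinner (Dvec w y j) (Dvec z y' j)) - cinner y y'"
  have diag: "(norm (feature w y))\<^sup>2 + (norm (Sadj w y))\<^sup>2 = (\<Sum>j\<in>UNIV. (norm (Dvec w y j))\<^sup>2) + (norm y)\<^sup>2"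
    if "w \<in> Bd" for w y
    using weak_coisometry_eq[OF that that, of y 0 y] by simp
  \<comment> \<open>For unimodular \<open>c\<close> the diagonal terms cancel by \<open>diag\<close>
    and only mixed terms remain; \<open>c = 1\<close> and \<open>c = \<i>\<close> then give the real
    and imaginary part of \<open>E\<close>.\<close>
  have zero: "Re (cnj c * E) = 0" if "cmod c = 1" for c
  proof -
    have "Re (cnj c * E) = Re (cinner (feature w y) (c *\<^sub>C feature z y')) + Re (cinner (Sadj w y) (c *\<^sub>C Sadj z y'))
      - (\<Sum>j\<in>UNIV. Re (cinner (Dvec w y j) (c *\<^sub>C Dvec z y' j))) - Re (cinner y (c *\<^sub>C y'))"
      by (simp only: E_def cinner_scaleC_right Re_sum[symmetric] sum_distrib_left[symmetric]
          right_diff_distrib distrib_left plus_complex.simps minus_complex.simps)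
    moreover note weak_coisometry_eq[OF zw, of y c y']
    ultimately show ?thesis
      using diag[OF zw(1), of y'] diag[OF zw(2), of y]
      by (simp add: norm_add_square norm_scaleC that sum.distrib sum_distrib_left[symmetric])
  qed
  have "E = 0" using zero[of 1] zero[of \<i>] by (simp add: complex_eq_iff)
  moreover have "(\<Sum>j\<in>UNIV. cinner (Dvec w y j) (Dvec z y' j)) = dinner z w * cinner (feature w y) (feature z y')"
    by (simp add: Dvec_def cinner_scaleC_left cinner_scaleC_right dinner_def sum_distrib_left mult_ac)
  ultimately show ?thesis by (simp add: E_def algebra_simps)
qed

text \<open>The state space itself carries the factorization, so a state can serve directly as a
  representing vector for \<open>HKS S\<close>.\<close>

sublocale model: kernel_feature "KS S" Bd feature
proof
  fix z w :: "complex ^ 'd" and y y' :: 'y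
  assume zw: "z \<in> Bd" "w \<in> Bd"
  have "dinner z w \<noteq> 1" using cmod_dinner_less_1[OF zw] by auto
  then have "cinner (feature w y) (feature z y') = (cinner y y' - cinner (Sadj w y) (Sadj z y')) / (1 - dinner z w)"
    using kernel_identity[OF zw, of y y'] by (simp add: field_simps)
  then show "cinner (KS S z w y) y' = cinner (feature w y) (feature z y')"
    by (simp add: KS_def kd_def cinner_scaleC_left cinner_diff_left cadjoint_S zw cinner_Sadj)
next
  fix z :: "complex ^ 'd" and c and y :: 'y
  assume "z \<in> Bd"
  then show "feature z (c *\<^sub>C y) = c *\<^sub>C feature z y"
    by (intro cinner_ext_right) (simp add: cinner_feature cinner_scaleC_right)
qed

section \<open>The observability map as a unitary onto \<open>HKS S\<close>\<close>

definition V :: "'x \<Rightarrow> complex ^ 'd \<Rightarrow> 'y" where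
  "V x = (\<lambda>z. if z \<in> Bd then C (resolvent z x) else 0)"

lemma V_add: "V (x + y) = (\<lambda>z. V x z + V y z)"
  by (simp add: V_def fun_eq_iff C_add linear_add[OF bounded_clinear_linear[OF clinear_resolvent]])

lemma V_scaleC: "V (c *\<^sub>C x) = (\<lambda>z. c *\<^sub>C V x z)"
  by (simp add: V_def fun_eq_iff C_scaleC bounded_clinear_scaleC[OF clinear_resolvent])

lemma V_sum: "finite I \<Longrightarrow> V (\<Sum>i\<in>I. f i) = (\<lambda>z. \<Sum>i\<in>I. V (f i) z)"
proof (induction I rule: finite_induct)
  case empty
  show ?case using V_scaleC[of 0 0] by (simp add: fun_eq_iff)
qed (simp add: V_add)

lemma V_at_0: "V x 0 = C x"
proof -
  have "resolvent 0 x = x"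
    by (rule resolvent_eqI) (simp_all add: mem_Bd_iff IZA_def)
  then show ?thesis by (simp add: V_def mem_Bd_iff)
qed

lemma V_represents: "model.represents x (V x)"
  by (simp add: model.represents_def V_def cinner_feature)

lemma V_eq_zero: "V x = (\<lambda>_. 0) \<Longrightarrow> x = 0"
  using observ unfolding observable_def V_def resolvent_def by (metis)

text \<open>By observability only the zero state is orthogonal to all features. Hence no state has
  to be projected before its norm is compared with that of \<open>V x\<close>, and \<open>V\<close>
  is isometric.\<close>

lemma all_minimal: "model.minimal x"
  unfolding model.minimal_def
proof (intro allI impI)
  fix v assume v: "\<forall>z\<in>Bd. \<forall>y. cinner v (feature z y) = 0"
  have "V v z = 0" for z
  proof (cases "z \<in> Bd")
    case True
    then have "cinner (V v z) y = cinner 0 y" for y using v cinner_feature[of z v y] by (simp add: V_def)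
    then show ?thesis by (rule cinner_ext)
  qed (simp add: V_def)
  then have "v = 0" by (intro V_eq_zero) (simp add: fun_eq_iff)
  then show "cinner v x = 0" by simp
qed

lemma nKS_V: "nKS S (V x) = norm x"
  unfolding nKS_def by (intro model.rkhs_norm_represents V_represents all_minimal)

lemma inj_V: "inj V"
proof (rule injI)
  fix x y assume "V x = V y"
  moreover have "V (x + (-1) *\<^sub>C y) = (\<lambda>z. V x z + (-1) *\<^sub>C V y z)" by (simp only: V_add V_scaleC)
  ultimately have "V (x - y) = (\<lambda>_. 0)" by (simp add: scaleC_one)
  then show "x = y" using V_eq_zero by fastforce
qed

lemma HKS_eq_range: "HKS S = range V"
proof
  show "range V \<subseteq> HKS S" using model.rkhs_represents[OF V_represents] by (auto simp: HKS_def)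
  show "HKS S \<subseteq> range V"
  proof
    fix f assume "f \<in> HKS S"
    then obtain x where "model.represents x f" unfolding HKS_def by (rule model.rkhs_obtain)
    then have "f = V x" using V_represents by (rule model.represents_unique)
    then show "f \<in> range V" by simp
  qed
qed

section \<open>Fock coefficients of states and the action of \<open>Mstar\<close>\<close>

text \<open>\<open>fold\<close> applies the first letter first, so deleting a leading
  \<open>j\<close> amounts to replacing \<open>x\<close> by \<open>A j x\<close>, as
  \<open>Mstar_V\<close> requires.\<close>

definition fock_coeffs :: "'x \<Rightarrow> ('d list, 'y) ell2" where
  "fock_coeffs x = Abs_ell2 (\<lambda>\<alpha>. C (fold A \<alpha> x))"

lemma fock_coeffs_nth: "ell2_nth (fock_coeffs x) \<alpha> = C (fold A \<alpha> x)"
proof -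
  have "(\<lambda>\<alpha>. (norm (C (fold A \<alpha> x)))\<^sup>2) summable_on UNIV"
  proof (rule square_summable_words)
    fix N
    show "(\<Sum>n<N. \<Sum>\<alpha> | length \<alpha> = n. (norm (C (fold A \<alpha> x)))\<^sup>2) \<le> (norm x)\<^sup>2"
    \<comment> \<open>The first letter is split off and the hypothesis used at every
      \<open>A j x\<close>; \<open>contraction_AC\<close> absorbs the empty word's term
      \<open>(norm (C x))^2\<close>.\<close>
    proof (induction N arbitrary: x)
      case (Suc N)
      have "(\<Sum>n<Suc N. \<Sum>\<alpha> | length \<alpha> = n. (norm (C (fold A \<alpha> x)))\<^sup>2)
          = (norm (C x))\<^sup>2 + (\<Sum>n<N. \<Sum>j\<in>UNIV. \<Sum>\<alpha> | length \<alpha> = n. (norm (C (fold A \<alpha> (A j x))))\<^sup>2)"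
        by (simp add: sum.lessThan_Suc_shift sum_words_Suc del: sum.lessThan_Suc)
      also have "\<dots> = (norm (C x))\<^sup>2 + (\<Sum>j\<in>UNIV. \<Sum>n<N. \<Sum>\<alpha> | length \<alpha> = n. (norm (C (fold A \<alpha> (A j x))))\<^sup>2)"
        by (simp only: sum.swap[of _ "{..<N}"])
      also have "\<dots> \<le> (norm (C x))\<^sup>2 + (\<Sum>j\<in>UNIV. (norm (A j x))\<^sup>2)"
        by (intro add_left_mono sum_mono Suc)
      also have "\<dots> \<le> (norm x)\<^sup>2" using contraction_AC[of x] by simp
      finally show ?case .
    qed simp
  qed
  then show ?thesis by (simp add: fock_coeffs_def Abs_ell2_inverse)
qed

lemma sum_words_fold: "(\<Sum>\<alpha> | length \<alpha> = n. word_monomial z \<alpha> *\<^sub>C fold A \<alpha> x) = (ZA z ^^ n) x"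
proof (induction n arbitrary: x)
  case (Suc n)
  have "(\<Sum>\<alpha> | length \<alpha> = Suc n. word_monomial z \<alpha> *\<^sub>C fold A \<alpha> x)
      = (\<Sum>j\<in>UNIV. (z $ j) *\<^sub>C (\<Sum>\<alpha> | length \<alpha> = n. word_monomial z \<alpha> *\<^sub>C fold A \<alpha> (A j x)))"
    by (simp add: sum_words_Suc scaleC_sum_right scaleC_scaleC)
  also have "\<dots> = (ZA z ^^ n) (ZA z x)"
    by (simp add: Suc ZA_def[of z x] ZA_pow_sum ZA_pow_scaleC)
  finally show ?case by (simp add: funpow_swap1)
qed (simp add: scaleC_one)

text \<open>The second representative of \<open>V x\<close>: the Neumann series of the resolvent,
  expanded over words. It places \<open>V x\<close> in the space where \<open>Mstar\<close> is
  defined.\<close>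

lemma V_represents_fock: "fock.represents (fock_coeffs x) (V x)"
proof -
  have "cinner (V x z) y = cinner (fock_coeffs x) (fock_kernel z y)" if z: "z \<in> Bd" for z y
  proof -
    define r where "r = resolvent z x"
    \<comment> \<open>This makes the partial sums telescope, so convergence to \<open>r\<close>
      reduces to the decay of \<open>(ZA z ^^ N) r\<close>.\<close>
    have x: "x = r - ZA z r" using IZA_resolvent[OF z, of x] by (simp add: IZA_eq r_def)
    have pow: "(ZA z ^^ n) x = (ZA z ^^ n) r - (ZA z ^^ Suc n) r" for n
    proof -
      have "(ZA z ^^ n) (x + ZA z r) = (ZA z ^^ n) x + (ZA z ^^ n) (ZA z r)" by (rule ZA_pow_add)
      moreover have "x + ZA z r = r" using x by simp
      ultimately show ?thesis by (simp add: funpow_Suc_right del: funpow.simps)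
    qed
    have partial: "(\<Sum>n<N. (ZA z ^^ n) x) = r - (ZA z ^^ N) r" for N
      by (induction N) (simp_all add: pow)
    have "(\<lambda>N. norm z ^ N * norm r) \<longlonglongrightarrow> 0 * norm r"
      using z by (intro tendsto_mult LIMSEQ_power_zero tendsto_const) (simp add: mem_Bd_iff)
    then have "(\<lambda>N. norm z ^ N * norm r) \<longlonglongrightarrow> 0" by simp
    then have "(\<lambda>N. (ZA z ^^ N) r) \<longlonglongrightarrow> 0"
      by (rule Lim_null_comparison[rotated]) (simp add: norm_ZA_pow_le)
    then have "(\<lambda>N. r - (ZA z ^^ N) r) \<longlonglongrightarrow> r - 0" by (intro tendsto_diff tendsto_const)
    then have "(\<lambda>n. (ZA z ^^ n) x) sums r" by (simp add: sums_def partial)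
    then have "(\<lambda>n. C ((ZA z ^^ n) x)) sums C r"
      by (rule bounded_linear.sums[OF bounded_clinear_bounded_linear[OF clinear_C]])
    then have "(\<lambda>N. cinner (\<Sum>n<N. C ((ZA z ^^ n) x)) y) \<longlonglongrightarrow> cinner (C r) y"
      unfolding sums_def by (rule tendsto_cinner_left)
    then have 1: "(\<lambda>n. cinner (C ((ZA z ^^ n) x)) y) sums cinner (C r) y"
      by (simp add: sums_def cinner_sum_left)
    have "(\<Sum>\<alpha> | length \<alpha> = n. word_monomial z \<alpha> * cinner (C (fold A \<alpha> x)) y) = cinner (C ((ZA z ^^ n) x)) y" for n
      unfolding sum_words_fold[symmetric]
      by (simp add: linear_sum[OF bounded_clinear_linear[OF clinear_C]] C_scaleC cinner_sum_left cinner_scaleC_left)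
    then have 2: "(\<lambda>n. cinner (C ((ZA z ^^ n) x)) y) sums cinner (fock_coeffs x) (fock_kernel z y)"
      using cinner_fock_kernel_sums[OF z, of "fock_coeffs x" y] by (simp add: fock_coeffs_nth)
    show ?thesis using sums_unique2[OF 1 2] z by (simp add: V_def r_def)
  qed
  then show ?thesis by (simp add: fock.represents_def V_def)
qed

lemma minimal_fock_coeffs: "fock.minimal (fock_coeffs x)"
proof (rule minimal_symmetric)
  fix \<alpha> \<beta> :: "'d list" assume "mset \<alpha> = mset \<beta>"
  then have "fold A \<alpha> = fold A \<beta>"
    using comm by (intro fold_multiset_equiv) (auto simp: commutative_def)
  then show "ell2_nth (fock_coeffs x) \<alpha> = ell2_nth (fock_coeffs x) \<beta>" by (simp add: fock_coeffs_nth)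
qed

lemma Mstar_V: "Mstar j (V x) = V (A j x)"
  by (rule Mstar_represents[OF V_represents_fock minimal_fock_coeffs V_represents_fock minimal_fock_coeffs])
     (simp add: fock_coeffs_nth)

section \<open>Existence and uniqueness of the functional-model realization\<close>

text \<open>\<open>V\<close> carries \<open>IZA z A\<close> to the map that
  \<open>fm_realization\<close> inverts, so its bijectivity and its inverse can be read off from
  \<open>resolvent\<close>.\<close>

lemma Mstar_V_IZA: "(\<lambda>w. V x w - (\<Sum>j\<in>UNIV. (z $ j) *\<^sub>C Mstar j (V x) w)) = V (IZA z A x)"
proof -
  have "V (IZA z A x + ZA z x) = (\<lambda>w. V (IZA z A x) w + V (ZA z x) w)" by (rule V_add)
  then show ?thesis
    by (simp add: IZA_eq Mstar_V ZA_def V_sum V_scaleC fun_eq_iff)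
qed

lemma S_0: "blinfun_apply (S 0) u = D u"
  by (simp add: S_eq mem_Bd_iff C_zero linear_0[OF bounded_clinear_linear[OF clinear_resolvent]])

lemma fm_realization_V: "fm_realization S (\<lambda>j u. V (B j u))"
  unfolding fm_realization_def
proof (intro conjI allI ballI)
  show "Mstar j f \<in> HKS S" if "f \<in> HKS S" for j f
    using that by (auto simp: HKS_eq_range Mstar_V)
  show "V (B j u) \<in> HKS S" for j u by (simp add: HKS_eq_range)
  show "V (B j (u + v)) = (\<lambda>z. V (B j u) z + V (B j v) z)" for j u v
    by (simp add: linear_add[OF bounded_clinear_linear[OF clinear_B]] V_add)
  show "V (B j (c *\<^sub>C u)) = (\<lambda>z. c *\<^sub>C V (B j u) z)" for j c u
    by (simp add: bounded_clinear_scaleC[OF clinear_B] V_scaleC)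
  show "(\<Sum>j\<in>UNIV. (nKS S (\<lambda>z. Mstar j f z + V (B j u) z))\<^sup>2) + (norm (f 0 + blinfun_apply (S 0) u))\<^sup>2
      \<le> (nKS S f)\<^sup>2 + (norm u)\<^sup>2" if mem: "f \<in> HKS S" for f u
  proof -
    obtain x where f: "f = V x" using mem by (auto simp: HKS_eq_range)
    have "contractive_conn A B C D" using weak_coisometry by (simp add: weakly_coisometric_def)
    then show ?thesis
      by (simp add: contractive_conn_def f Mstar_V V_add[symmetric] nKS_V V_at_0 S_0)
  qed
next
  fix z :: "complex ^ 'd" assume z: "z \<in> Bd"
  let ?\<Phi> = "\<lambda>f w. f w - (\<Sum>j\<in>UNIV. (z $ j) *\<^sub>C Mstar j f w)"
  have inj: "inj_on ?\<Phi> (HKS S)"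
  proof (rule inj_onI)
    fix f g assume "f \<in> HKS S" "g \<in> HKS S" and eq: "?\<Phi> f = ?\<Phi> g"
    then obtain x y where fg: "f = V x" "g = V y" by (auto simp: HKS_eq_range)
    then have "V (IZA z A x) = V (IZA z A y)" using eq by (simp only: Mstar_V_IZA)
    then have "IZA z A x = IZA z A y" by (rule injD[OF inj_V])
    then show "f = g" using resolvent_IZA[OF z] fg by metis
  qed
  have \<Phi>: "?\<Phi> (V (resolvent z x)) = V x" for x
    by (simp only: Mstar_V_IZA IZA_resolvent[OF z])
  show "bij_betw ?\<Phi> (HKS S) (HKS S)"
    unfolding bij_betw_def
  proof (intro conjI inj equalityI subsetI)
    show "f \<in> HKS S" if "f \<in> ?\<Phi> ` HKS S" for f
      using that by (auto simp: HKS_eq_range Mstar_V_IZA)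
    show "f \<in> ?\<Phi> ` HKS S" if mem: "f \<in> HKS S" for f
    proof -
      obtain x where "f = V x" using mem by (auto simp: HKS_eq_range)
      then show ?thesis
        by (intro image_eqI[of _ _ "V (resolvent z x)"]) (simp_all only: \<Phi> HKS_eq_range rangeI)
    qed
  qed
  fix u
  have "inv_into (HKS S) ?\<Phi> (\<lambda>w. \<Sum>j\<in>UNIV. (z $ j) *\<^sub>C V (B j u) w)
      = V (resolvent z (\<Sum>j\<in>UNIV. (z $ j) *\<^sub>C B j u))"
  proof (rule inv_into_f_eq[OF inj])
    show "?\<Phi> (V (resolvent z (\<Sum>j\<in>UNIV. (z $ j) *\<^sub>C B j u))) = (\<lambda>w. \<Sum>j\<in>UNIV. (z $ j) *\<^sub>C V (B j u) w)"
      unfolding \<Phi> by (simp add: V_sum V_scaleC)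
  qed (simp add: HKS_eq_range)
  then show "blinfun_apply (S z) u = blinfun_apply (S 0) u
      + inv_into (HKS S) ?\<Phi> (\<lambda>w. \<Sum>j\<in>UNIV. (z $ j) *\<^sub>C V (B j u) w) 0"
    by (simp add: V_at_0 S_0 S_eq[OF z])
qed

lemma unitarily_equiv_V: "unitarily_equiv_fm S A B C D (\<lambda>j u. V (B j u))"
  unfolding unitarily_equiv_fm_def
proof (intro exI[of _ V] conjI allI)
  show "bij_betw V UNIV (HKS S)" by (simp add: bij_betw_def inj_V HKS_eq_range)
qed (simp_all add: V_add V_scaleC nKS_V Mstar_V V_at_0 S_0)

text \<open>An intertwiner \<open>V'\<close> equals \<open>V\<close>: the operator \<open>V\<inverse> V'\<close> commutes with every \<open>A j\<close> and
  is absorbed by \<open>C\<close>, so observability makes it the identity.\<close>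

lemma unitarily_equiv_unique:
  assumes "unitarily_equiv_fm S A B C D Bt"
  shows "Bt = (\<lambda>j u. V (B j u))"
proof -
  obtain V' where bij: "bij_betw V' UNIV (HKS S)"
    and add: "\<And>x y. V' (x + y) = (\<lambda>z. V' x z + V' y z)"
    and scale: "\<And>c x. V' (c *\<^sub>C x) = (\<lambda>z. c *\<^sub>C V' x z)"
    and AB: "\<And>j x u. V' (A j x + B j u) = (\<lambda>z. Mstar j (V' x) z + Bt j u z)"
    and CD: "\<And>x u. C x + D u = V' x 0 + blinfun_apply (S 0) u"
    using assms unfolding unitarily_equiv_fm_def by (elim exE conjE) (rule that, assumption, blast+)
  have V'0: "V' 0 = (\<lambda>_. 0)" using scale[of 0 0] by simp
  have V0: "V 0 = (\<lambda>_. 0)" using V_scaleC[of 0 0] by simp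
  have "\<exists>y. V' x = V y" for x
    using bij_betw_imp_surj_on[OF bij] by (auto simp: HKS_eq_range)
  then obtain W where W: "\<And>x. V' x = V (W x)" by metis
  have W_add: "W (x + y) = W x + W y" for x y
    by (rule injD[OF inj_V]) (simp add: W[symmetric] add V_add)
  have W_scale: "W (c *\<^sub>C x) = c *\<^sub>C W x" for c x
    by (rule injD[OF inj_V]) (simp add: W[symmetric] scale V_scaleC)
  \<comment> \<open>At the zero state the intertwining relation leaves only the input part, so
    \<open>V'\<close> determines \<open>Bt\<close>.\<close>
  have Bt: "Bt j u = V' (B j u)" for j u
    using AB[of j 0 u] Mstar_V[of j 0] by (simp add: A_zero V'0 V0)
  have Bt0: "Bt j 0 = (\<lambda>_. 0)" for j by (simp add: Bt B_zero V'0)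
  have WA: "W (A j x) = A j (W x)" for j x
    using AB[of j x 0] by (intro injD[OF inj_V]) (simp add: W[symmetric] Mstar_V[symmetric] B_zero Bt0)
  have CW: "C (W x) = C x" for x
    using CD[of x 0] by (simp add: D_zero S_0 W V_at_0)
  have W_sum: "finite I \<Longrightarrow> W (\<Sum>i\<in>I. f i) = (\<Sum>i\<in>I. W (f i))" for I :: "'d set" and f
  proof (induction I rule: finite_induct)
    case empty
    show ?case using W_scale[of 0 0] by simp
  qed (simp add: W_add)
  have W_ZA: "W (ZA z x) = ZA z (W x)" for z x
    by (simp add: ZA_def W_sum W_scale WA)
  have W_IZA: "W (IZA z A x) = IZA z A (W x)" for z x
    using W_add[of "IZA z A x" "ZA z x", symmetric] by (simp only: IZA_eq W_ZA diff_add_cancel eq_diff_eq)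
  have "V' x = V x" for x
  proof
    fix z
    show "V' x z = V x z"
    proof (cases "z \<in> Bd")
      case True
      \<comment> \<open>\<open>W\<close> moves out of the resolvent and is then absorbed by
        \<open>C\<close>, which equates the values of \<open>V' x\<close> and \<open>V x\<close> at
        \<open>z\<close>.\<close>
      have "resolvent z (W x) = W (resolvent z x)"
        by (rule resolvent_eqI[OF True]) (simp add: W_IZA[symmetric] IZA_resolvent[OF True])
      then show ?thesis by (simp add: W V_def CW)
    qed (simp add: W V_def)
  qed
  then show ?thesis by (simp add: fun_eq_iff Bt)
qed

end

theorem theorem3p6:
  fixes S :: "complex ^ 'd::finite \<Rightarrow> ('u::chilbert \<Rightarrow>\<^sub>L 'y::chilbert)"
    and A :: "'d \<Rightarrow> 'x::chilbert \<Rightarrow> 'x"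
    and B :: "'d \<Rightarrow> 'u \<Rightarrow> 'x"
    and C :: "'x \<Rightarrow> 'y"
    and D :: "'u \<Rightarrow> 'y"
  assumes "schur_class S"
    and "\<exists>Bt. fm_realization S Bt"
    and "is_realization S A B C D"
    and "commutative A"
    and "observable A C"
    and "weakly_coisometric A B C D"
  shows "\<exists>!Bt. fm_realization S Bt \<and> unitarily_equiv_fm S A B C D Bt"
proof -
  interpret weakly_coisometric_realization S A B C D
    by unfold_locales (use assms in auto)
  show ?thesis
    using fm_realization_V unitarily_equiv_V unitarily_equiv_unique by blast
qed

end
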